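(* Let $q$ be an arbitrary real or complex number and let $d\ge 1$. Let $(\mathcal{A},\phi)$ and $(\mathcal{B},\psi)$ be probability spaces with expectations $\mathbb{E}$ and $\mathbb{E}'$, supported by Hilbert spaces $H$ and $H'$, respectively. Let $X=(X_1,\ldots,X_d)$ with $X_i\in\mathcal{A}$ and $Y=(Y_1,\ldots,Y_d)$ with $Y_i\in\mathcal{B}$ be random vectors, with $\mathcal{A}$ generated by the symmetric operators $X_1,\ldots,X_d$ and $\mathcal{B}$ generated by the symmetric operators $Y_1,\ldots,Y_d$. Then $X$ and $Y$ are moment equal if and only if the following three conditions hold for all $i,j\in\{1,\ldots,d\}$: \[ [a_X^-(i);a_X^+(j)]_q=[a_Y^-(i);a_Y^+(j)]_q, \] \[ [a_X^-(i);a_X^0(j)]_q=[a_Y^-(i);a_Y^0(j)]_q, \] \[ \mathbb{E}[X_i]=\mathbb{E}'[Y_i]. \] Here $a_U^-(i)$, $a_U^0(i)$, $a_U^+(i)$ are the annihilation, preservation and creation operators associated with the $i$-th coordinate of a random vector $U$, and equality of the operators associated with $X$ and with $Y$ is understood as explained in the context.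
   Context: **Probability spaces.** Let $(H,\langle\cdot,\cdot\rangle)$ be a real Hilbert space and $X_1,\ldots,X_d$ symmetric, densely defined linear operators on $H$. $\mathcal{A}$ is the unital algebra generated by $X_1,\ldots,X_d$ (containing the identity $I$); every $g\in\mathcal{A}$ is of the form $p(X_1,\ldots,X_d)$ with $p$ a polynomial in $d$ noncommutative variables. A unit vector $\phi\in H$ (the vacuum vector) lying in the domain of every $g\in\mathcal{A}$ is fixed. The pair $(\mathcal{A},\phi)$ is called a probability space supported by $H$, elements of $\mathcal{A}$ are called random variables, and $\mathbb{E}[g]:=\langle g\phi,\phi\rangle$ is the expectation of $g$. **Moment equality.** $(X_1,\ldots,X_d)$ and $(Y_1,\ldots,Y_d)$ are moment equal if $\mathbb{E}[p(X_1,\ldots,X_d)]=\mathbb{E}'[p(Y_1,\ldots,Y_d)]$ for every polynomial $p$ in $d$ noncommutative variables. **Annihilation, preservation, creation operators.** For $n\ge 0$ let $F_n=\{p(X_1,\ldots,X_d)\phi: p \text{ a noncommutative polynomial of total degree}\le n\}$, a finite-dimensional subspace of $H$. Put $G_{-1}=\{0\}$, $G_0=F_0$, and for $n\ge1$ let $G_n$ be the orthogonal complement of $F_{n-1}$ in $F_n$. Then $\mathcal{A}\phi=\{g\phi:g\in\mathcal{A}\}$ is the algebraic direct sum of the $G_n$, and by symmetry $X_iG_n\subset G_{n-1}\oplus G_n\oplus G_{n+1}$. Hence there are unique linear operators $a_X^-(i),a_X^0(i),a_X^+(i)$ with domain $\mathcal{A}\phi$ such that $X_i=a_X^-(i)+a_X^0(i)+a_X^+(i)$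 on $\mathcal{A}\phi$ and $a_X^-(i)(G_n)\subset G_{n-1}$, $a_X^0(i)(G_n)\subset G_n$, $a_X^+(i)(G_n)\subset G_{n+1}$ for all $n\ge 0$. The operators for $Y$ are defined analogously on $\mathcal{B}\psi$. **$q$-commutator.** $[A;B]_q:=AB-q\,BA$. (If $q$ is not real, operators are extended linearly to the complexification.) **Equality of operators for $X$ and $Y$.** Operators $S$ on $\mathcal{A}\phi$ and $T$ on $\mathcal{B}\psi$ that map vectors of degree at most $n$ to vectors of degree at most $n$ are regarded as equal, $S=T$, if they act in the same way on polynomials: for every $n\ge0$ and every noncommutative polynomial $p$ of total degree $\le n$ there is a noncommutative polynomial $r$ of total degree $\le n$ (with complex coefficients if $q$ is not real) such that $S\,p(X_1,\ldots,X_d)\phi=r(X_1,\ldots,X_d)\phi$ and $T\,p(Y_1,\ldots,Y_d)\psi=r(Y_1,\ldots,Y_d)\psi$. *)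

theory Defs
  imports "HOL-Analysis.Analysis" "HOL-Library.Poly_Mapping"
begin

section \<open>Unbounded operators\<close>

text \<open>
  An operator with its domain is a partial map \<open>'a \<rightharpoonup> 'a\<close>: the domain is \<open>dom A\<close>, and
  composition with its natural domain is \<open>A \<circ>\<^sub>m B\<close>.
\<close>

definition linear_operator :: "('a::real_vector \<rightharpoonup> 'a) \<Rightarrow> bool" where
  "linear_operator A \<longleftrightarrow>
     subspace (dom A) \<and>
     (\<forall>x\<in>dom A. \<forall>y\<in>dom A. the (A (x + y)) = the (A x) + the (A y)) \<and>
     (\<forall>c. \<forall>x\<in>dom A. the (A (c *\<^sub>R x)) = c *\<^sub>R the (A x))"

definition densely_defined :: "('a::real_normed_vector \<rightharpoonup> 'a) \<Rightarrow> bool" where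
  "densely_defined A \<longleftrightarrow> closure (dom A) = UNIV"

definition symmetric_operator :: "('a::real_inner \<rightharpoonup> 'a) \<Rightarrow> bool" where
  "symmetric_operator A \<longleftrightarrow> (\<forall>x\<in>dom A. \<forall>y\<in>dom A. the (A x) \<bullet> y = x \<bullet> the (A y))"

section \<open>Noncommutative polynomials\<close>

text \<open>
  The variables are indexed by a finite type \<open>'d\<close>, so \<open>d = CARD('d) \<ge> 1\<close>.  A monomial is a word
  over \<open>'d\<close>, and a polynomial a finitely supported family of coefficients.  The zero polynomial
  has degree at most \<open>n\<close> for every \<open>n\<close>.
\<close>

type_synonym ('d, 'c) ncpoly = "'d list \<Rightarrow>\<^sub>0 'c"

definition deg_le :: "nat \<Rightarrow> ('d, 'c::zero) ncpoly \<Rightarrow> bool" where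
  "deg_le n p \<longleftrightarrow> (\<forall>w\<in>Poly_Mapping.keys p. length w \<le> n)"

primrec word_op :: "('d \<Rightarrow> 'a \<rightharpoonup> 'a) \<Rightarrow> 'd list \<Rightarrow> 'a \<rightharpoonup> 'a" where
  "word_op X [] = Some"
| "word_op X (i # w) = X i \<circ>\<^sub>m word_op X w"

definition poly_op :: "('d \<Rightarrow> 'a \<rightharpoonup> 'a) \<Rightarrow> ('d, real) ncpoly \<Rightarrow> 'a::real_vector \<rightharpoonup> 'a" where
  "poly_op X p v =
     (if \<forall>w\<in>Poly_Mapping.keys p. v \<in> dom (word_op X w)
      then Some (\<Sum>w\<in>Poly_Mapping.keys p. Poly_Mapping.lookup p w *\<^sub>R the (word_op X w v))
      else None)"

section \<open>Probability spaces\<close>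

definition generated_algebra :: "('d \<Rightarrow> 'a::real_vector \<rightharpoonup> 'a) \<Rightarrow> ('a \<rightharpoonup> 'a) set" where
  "generated_algebra X = {poly_op X p |p. True}"

definition probability_space ::
    "('d::finite \<Rightarrow> 'a::{real_inner, complete_space} \<rightharpoonup> 'a) \<Rightarrow> 'a \<Rightarrow> bool" where
  "probability_space X \<phi> \<longleftrightarrow>
     (\<forall>i. linear_operator (X i) \<and> densely_defined (X i) \<and> symmetric_operator (X i)) \<and>
     norm \<phi> = 1 \<and> (\<forall>g\<in>generated_algebra X. \<phi> \<in> dom g)"

definition expectation :: "'a::real_inner \<Rightarrow> ('a \<rightharpoonup> 'a) \<Rightarrow> real" where
  "expectation \<phi> g = the (g \<phi>) \<bullet> \<phi>"

definition moment_equal ::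
    "('d \<Rightarrow> 'a::real_inner \<rightharpoonup> 'a) \<Rightarrow> 'a \<Rightarrow> ('d \<Rightarrow> 'b::real_inner \<rightharpoonup> 'b) \<Rightarrow> 'b \<Rightarrow> bool" where
  "moment_equal X \<phi> Y \<psi> \<longleftrightarrow>
     (\<forall>p. expectation \<phi> (poly_op X p) = expectation \<psi> (poly_op Y p))"

section \<open>Annihilation, preservation and creation operators\<close>

definition cyclic_space :: "('d \<Rightarrow> 'a::real_vector \<rightharpoonup> 'a) \<Rightarrow> 'a \<Rightarrow> 'a set" where
  "cyclic_space X \<phi> = {the (g \<phi>) |g. g \<in> generated_algebra X}"

definition F_space :: "('d \<Rightarrow> 'a::real_vector \<rightharpoonup> 'a) \<Rightarrow> 'a \<Rightarrow> nat \<Rightarrow> 'a set" where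
  "F_space X \<phi> n = {the (poly_op X p \<phi>) |p. deg_le n p}"

text \<open>The index is an integer so that \<open>G\<^sub>-\<^sub>1 = {0}\<close> is included.\<close>

definition G_space :: "('d \<Rightarrow> 'a::real_inner \<rightharpoonup> 'a) \<Rightarrow> 'a \<Rightarrow> int \<Rightarrow> 'a set" where
  "G_space X \<phi> k =
     (if k < 0 then {0}
      else if k = 0 then F_space X \<phi> 0
      else F_space X \<phi> (nat k) \<inter> (F_space X \<phi> (nat k - 1))\<^sup>\<bottom>)"

definition is_quantum_decomposition ::
    "('d \<Rightarrow> 'a::real_inner \<rightharpoonup> 'a) \<Rightarrow> 'a \<Rightarrow> 'd \<Rightarrow>
     ('a \<rightharpoonup> 'a) \<Rightarrow> ('a \<rightharpoonup> 'a) \<Rightarrow> ('a \<rightharpoonup> 'a) \<Rightarrow> bool" where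
  "is_quantum_decomposition X \<phi> i am a0 ap \<longleftrightarrow>
     (\<forall>A\<in>{am, a0, ap}. linear_operator A \<and> dom A = cyclic_space X \<phi>) \<and>
     (\<forall>v\<in>cyclic_space X \<phi>. X i v = Some (the (am v) + the (a0 v) + the (ap v))) \<and>
     (\<forall>n::nat. \<forall>v\<in>G_space X \<phi> (int n).
        the (am v) \<in> G_space X \<phi> (int n - 1) \<and>
        the (a0 v) \<in> G_space X \<phi> (int n) \<and>
        the (ap v) \<in> G_space X \<phi> (int n + 1))"

definition quantum_decomposition ::
    "('d \<Rightarrow> 'a::real_inner \<rightharpoonup> 'a) \<Rightarrow> 'a \<Rightarrow> 'd \<Rightarrow> ('a \<rightharpoonup> 'a) \<times> ('a \<rightharpoonup> 'a) \<times> ('a \<rightharpoonup> 'a)" where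
  "quantum_decomposition X \<phi> i =
     (THE t. case t of (am, a0, ap) \<Rightarrow> is_quantum_decomposition X \<phi> i am a0 ap)"

definition annihilation :: "('d \<Rightarrow> 'a::real_inner \<rightharpoonup> 'a) \<Rightarrow> 'a \<Rightarrow> 'd \<Rightarrow> 'a \<rightharpoonup> 'a" where
  "annihilation X \<phi> i = fst (quantum_decomposition X \<phi> i)"

definition preservation :: "('d \<Rightarrow> 'a::real_inner \<rightharpoonup> 'a) \<Rightarrow> 'a \<Rightarrow> 'd \<Rightarrow> 'a \<rightharpoonup> 'a" where
  "preservation X \<phi> i = fst (snd (quantum_decomposition X \<phi> i))"

definition creation :: "('d \<Rightarrow> 'a::real_inner \<rightharpoonup> 'a) \<Rightarrow> 'a \<Rightarrow> 'd \<Rightarrow> 'a \<rightharpoonup> 'a" where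
  "creation X \<phi> i = snd (snd (quantum_decomposition X \<phi> i))"

section \<open>The q-commutator and equality of operators\<close>

text \<open>
  The pair \<open>(x, y)\<close> in \<open>'a \<times> 'a\<close> stands for \<open>x + \<i>y\<close> in the complexification, and \<open>(x, 0)\<close> for the
  real vector \<open>x\<close>.  For real \<open>q\<close> nothing leaves the real space: on real vectors the
  \<open>q\<close>-commutator below is \<open>(x, 0) \<mapsto> (A (B x) - q B (A x), 0)\<close>.
\<close>

definition cscale :: "complex \<Rightarrow> 'a::real_vector \<times> 'a \<Rightarrow> 'a \<times> 'a" where
  "cscale c z = (Re c *\<^sub>R fst z - Im c *\<^sub>R snd z, Re c *\<^sub>R snd z + Im c *\<^sub>R fst z)"

definition complexify :: "('a \<rightharpoonup> 'a) \<Rightarrow> 'a \<times> 'a \<rightharpoonup> 'a \<times> 'a" where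
  "complexify A z =
     (if fst z \<in> dom A \<and> snd z \<in> dom A then Some (the (A (fst z)), the (A (snd z))) else None)"

definition q_commutator ::
    "complex \<Rightarrow> ('a::real_vector \<rightharpoonup> 'a) \<Rightarrow> ('a \<rightharpoonup> 'a) \<Rightarrow> 'a \<times> 'a \<rightharpoonup> 'a \<times> 'a" where
  "q_commutator q A B z =
     (let AB = complexify A \<circ>\<^sub>m complexify B; BA = complexify B \<circ>\<^sub>m complexify A
      in if z \<in> dom AB \<and> z \<in> dom BA then Some (the (AB z) - cscale q (the (BA z))) else None)"

definition cpoly_vec ::
    "('d \<Rightarrow> 'a::real_vector \<rightharpoonup> 'a) \<Rightarrow> ('d, complex) ncpoly \<Rightarrow> 'a \<Rightarrow> 'a \<times> 'a" where
  "cpoly_vec X r v =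
     (\<Sum>w\<in>Poly_Mapping.keys r. cscale (Poly_Mapping.lookup r w) (the (word_op X w v), 0))"

text \<open>The scalar \<open>q\<close> enters only to decide whether \<open>r\<close> may have non-real coefficients.\<close>

definition same_action ::
    "complex \<Rightarrow> ('d \<Rightarrow> 'a::real_vector \<rightharpoonup> 'a) \<Rightarrow> 'a \<Rightarrow> ('d \<Rightarrow> 'b::real_vector \<rightharpoonup> 'b) \<Rightarrow> 'b \<Rightarrow>
     ('a \<times> 'a \<rightharpoonup> 'a \<times> 'a) \<Rightarrow> ('b \<times> 'b \<rightharpoonup> 'b \<times> 'b) \<Rightarrow> bool" where
  "same_action q X \<phi> Y \<psi> S T \<longleftrightarrow>
     (\<forall>n. \<forall>p. deg_le n p \<longrightarrow>
        (\<exists>r. deg_le n r \<and> (q \<in> \<real> \<longrightarrow> (\<forall>w. Poly_Mapping.lookup r w \<in> \<real>)) \<and>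
             S (the (poly_op X p \<phi>), 0) = Some (cpoly_vec X r \<phi>) \<and>
             T (the (poly_op Y p \<psi>), 0) = Some (cpoly_vec Y r \<psi>)))"

section \<open>Existence and uniqueness of the decomposition\<close>

lemma orthogonal_projection_exists:
  fixes B :: "'a::real_inner set"
  assumes "finite B"
  obtains P where "linear P" "\<And>x. P x \<in> span B" "\<And>x u. u \<in> span B \<Longrightarrow> (x - P x) \<bullet> u = 0"
proof -
  obtain C where C: "finite C" "span C = span B" "pairwise orthogonal C"
    using basis_orthogonal[OF assms] by blast
  define P where "P x = (\<Sum>b\<in>C. (x \<bullet> b / (b \<bullet> b)) *\<^sub>R b)" for x
  have "linear P"
    unfolding P_def
    by (intro linearI)
      (simp_all add: inner_left_distrib add_divide_distrib scaleR_add_left sum.distrib scaleR_sum_right)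
  moreover have "P x \<in> span B" for x
    unfolding P_def C(2)[symmetric] by (intro span_sum span_scale span_base)
  moreover have "(x - P x) \<bullet> u = 0" if "u \<in> span B" for x u
  proof -
    have "orthogonal (x - P x) u"
    proof (rule orthogonal_to_span)
      show "u \<in> span C" using that C by simp
    next
      fix c assume c: "c \<in> C"
      have "P x \<bullet> c = (\<Sum>b\<in>C. (x \<bullet> b / (b \<bullet> b)) * (b \<bullet> c))"
        by (simp add: P_def inner_sum_left)
      also have "\<dots> = (\<Sum>b\<in>C. if b = c then x \<bullet> c else 0)"
      proof (rule sum.cong)
        fix b assume "b \<in> C"
        then show "(x \<bullet> b / (b \<bullet> b)) * (b \<bullet> c) = (if b = c then x \<bullet> c else 0)"
          using C(3) c by (auto simp: pairwise_def orthogonal_def)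
      qed simp
      also have "\<dots> = x \<bullet> c" using c C(1) by simp
      finally show "orthogonal (x - P x) c" by (simp add: orthogonal_def inner_diff_left)
    qed
    then show ?thesis by (simp add: orthogonal_def)
  qed
  ultimately show ?thesis using that by blast
qed

lemma linear_operator_domD:
  assumes "linear_operator A"
  shows "subspace (dom A)"
    and "\<And>x y. x \<in> dom A \<Longrightarrow> y \<in> dom A \<Longrightarrow> the (A (x + y)) = the (A x) + the (A y)"
    and "\<And>c x. x \<in> dom A \<Longrightarrow> the (A (c *\<^sub>R x)) = c *\<^sub>R the (A x)"
    and "the (A 0) = 0"
proof -
  show s: "subspace (dom A)" using assms by (simp add: linear_operator_def)
  show "the (A (x + y)) = the (A x) + the (A y)" if "x \<in> dom A" "y \<in> dom A" for x y
    using assms that by (simp add: linear_operator_def)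
  show *: "the (A (c *\<^sub>R x)) = c *\<^sub>R the (A x)" if "x \<in> dom A" for c x
    using assms that by (simp add: linear_operator_def)
  show "the (A 0) = 0" using *[of 0 0] subspace_0[OF s] by simp
qed

lemma linear_operator_sum:
  assumes A: "linear_operator A" and "finite I" and "\<And>k. k \<in> I \<Longrightarrow> f k \<in> dom A"
  shows "sum f I \<in> dom A \<and> the (A (sum f I)) = (\<Sum>k\<in>I. the (A (f k)))"
  using assms(2,3)
proof (induction I rule: finite_induct)
  case empty
  show ?case
    using subspace_0[OF linear_operator_domD(1)[OF A]] linear_operator_domD(4)[OF A] by simp
next
  case (insert k I)
  have IH: "sum f I \<in> dom A" "the (A (sum f I)) = (\<Sum>k\<in>I. the (A (f k)))"
    using insert.IH[OF insert.prems] by simp_all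
  have fk: "f k \<in> dom A" by (simp add: insert.prems)
  show ?case
    using insert.hyps IH(2) linear_operator_domD(2)[OF A fk IH(1)]
      subspace_add[OF linear_operator_domD(1)[OF A] fk IH(1)]
    by simp
qed

context
  fixes X :: "'d::finite \<Rightarrow> 'a::{real_inner, complete_space} \<rightharpoonup> 'a" and \<phi> :: 'a
  assumes ps: "probability_space X \<phi>"
begin

definition vac_word where "vac_word w = the (word_op X w \<phi>)"

lemma linX: "linear_operator (X i)" and symX: "symmetric_operator (X i)"
  using ps by (simp_all add: probability_space_def)

lemma in_dom_word: "\<phi> \<in> dom (word_op X w)"
proof -
  have "poly_op X (Poly_Mapping.single w 1) \<in> generated_algebra X"
    by (auto simp: generated_algebra_def)
  then have "\<phi> \<in> dom (poly_op X (Poly_Mapping.single w 1))"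
    using ps by (simp add: probability_space_def)
  then show ?thesis by (auto simp: poly_op_def dom_def split: if_splits)
qed

lemma word_op_Some: "word_op X w \<phi> = Some (vac_word w)"
  using in_dom_word[of w] by (auto simp: vac_word_def)

lemma X_W: "X i (vac_word w) = Some (vac_word (i # w))"
proof -
  have "word_op X (i # w) \<phi> = X i (vac_word w)" by (simp add: map_comp_def word_op_Some)
  then show ?thesis using word_op_Some[of "i # w"] by simp
qed

lemma poly_vac:
  "the (poly_op X p \<phi>) = (\<Sum>w\<in>Poly_Mapping.keys p. Poly_Mapping.lookup p w *\<^sub>R vac_word w)"
  using in_dom_word by (simp add: poly_op_def vac_word_def)

lemma finite_words: "finite {w::'d list. length w \<le> n}"
  using finite_lists_length_le[of "UNIV :: 'd set" n] by simp

lemma poly_vac_deg_le: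
  assumes "deg_le n p"
  shows "the (poly_op X p \<phi>) = (\<Sum>w | length w \<le> n. Poly_Mapping.lookup p w *\<^sub>R vac_word w)"
  unfolding poly_vac using assms finite_words
  by (intro sum.mono_neutral_left) (auto simp: deg_le_def in_keys_iff)

lemma F_space_span: "F_space X \<phi> n = span (vac_word ` {w. length w \<le> n})"
proof
  show "F_space X \<phi> n \<subseteq> span (vac_word ` {w. length w \<le> n})"
  proof
    fix v assume "v \<in> F_space X \<phi> n"
    then obtain p where "deg_le n p" "v = the (poly_op X p \<phi>)" by (auto simp: F_space_def)
    then have "v = (\<Sum>w | length w \<le> n. Poly_Mapping.lookup p w *\<^sub>R vac_word w)"
      by (simp add: poly_vac_deg_le)
    also have "\<dots> \<in> span (vac_word ` {w. length w \<le> n})"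
      by (intro span_sum span_scale span_base) auto
    finally show "v \<in> span (vac_word ` {w. length w \<le> n})" .
  qed
  show "span (vac_word ` {w. length w \<le> n}) \<subseteq> F_space X \<phi> n"
  proof (rule span_minimal)
    show "vac_word ` {w. length w \<le> n} \<subseteq> F_space X \<phi> n"
    proof
      fix v assume "v \<in> vac_word ` {w. length w \<le> n}"
      then obtain w where w: "length w \<le> n" "v = vac_word w" by blast
      then have "deg_le n (Poly_Mapping.single w (1::real))" by (simp add: deg_le_def)
      moreover have "the (poly_op X (Poly_Mapping.single w 1) \<phi>) = v" by (simp add: poly_vac w)
      ultimately show "v \<in> F_space X \<phi> n" unfolding F_space_def by blast
    qed
    show "subspace (F_space X \<phi> n)"
    proof (rule subspaceI)
      show "0 \<in> F_space X \<phi> n"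
        unfolding F_space_def by (auto simp: poly_vac deg_le_def intro!: exI[of _ 0])
    next
      fix x y assume "x \<in> F_space X \<phi> n" "y \<in> F_space X \<phi> n"
      then obtain p r where pr: "deg_le n p" "x = the (poly_op X p \<phi>)"
          "deg_le n r" "y = the (poly_op X r \<phi>)" by (auto simp: F_space_def)
      have d: "deg_le n (p + r)" using pr keys_add[of p r] by (auto simp: deg_le_def)
      have "x + y = the (poly_op X (p + r) \<phi>)"
        unfolding poly_vac_deg_le[OF d]
        by (simp add: pr(2,4) poly_vac_deg_le[OF pr(1)] poly_vac_deg_le[OF pr(3)] lookup_add
            scaleR_add_left sum.distrib)
      with d show "x + y \<in> F_space X \<phi> n" unfolding F_space_def by blast
    next
      fix c x assume "x \<in> F_space X \<phi> n"
      then obtain p where p: "deg_le n p" "x = the (poly_op X p \<phi>)" by (auto simp: F_space_def)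
      let ?r = "Poly_Mapping.map ((*) c) p"
      have l: "Poly_Mapping.lookup ?r w = c * Poly_Mapping.lookup p w" for w
        by (auto simp: map.rep_eq when_def)
      have d: "deg_le n ?r" using p by (auto simp: deg_le_def in_keys_iff l)
      have "c *\<^sub>R x = the (poly_op X ?r \<phi>)"
        unfolding poly_vac_deg_le[OF d] by (simp add: p(2) poly_vac_deg_le[OF p(1)] l scaleR_sum_right)
      with d show "c *\<^sub>R x \<in> F_space X \<phi> n" unfolding F_space_def by blast
    qed
  qed
qed

lemma subspace_F: "subspace (F_space X \<phi> n)"
  by (simp add: F_space_span)

lemma F_mono: "m \<le> n \<Longrightarrow> F_space X \<phi> m \<subseteq> F_space X \<phi> n"
  unfolding F_space_span by (intro span_mono) auto

lemma cyclic_Union: "cyclic_space X \<phi> = (\<Union>n. F_space X \<phi> n)"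
proof -
  have "\<exists>n. deg_le n p" for p :: "('d, real) ncpoly"
    by (rule exI[of _ "Max (length ` Poly_Mapping.keys p)"]) (auto simp: deg_le_def)
  then show ?thesis
    unfolding cyclic_space_def F_space_def generated_algebra_def by blast
qed

lemma subspace_cyclic: "subspace (cyclic_space X \<phi>)"
proof (rule subspaceI)
  show "0 \<in> cyclic_space X \<phi>" unfolding cyclic_Union using subspace_0[OF subspace_F] by blast
next
  fix x y assume "x \<in> cyclic_space X \<phi>" "y \<in> cyclic_space X \<phi>"
  then obtain m n where "x \<in> F_space X \<phi> m" "y \<in> F_space X \<phi> n" unfolding cyclic_Union by blast
  then have "x \<in> F_space X \<phi> (max m n)" "y \<in> F_space X \<phi> (max m n)"
    using F_mono[of m "max m n"] F_mono[of n "max m n"] by auto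
  then have "x + y \<in> F_space X \<phi> (max m n)" by (rule subspace_add[OF subspace_F])
  then show "x + y \<in> cyclic_space X \<phi>" unfolding cyclic_Union by blast
next
  fix c x assume "x \<in> cyclic_space X \<phi>"
  then show "c *\<^sub>R x \<in> cyclic_space X \<phi>"
    unfolding cyclic_Union using subspace_scale[OF subspace_F] by blast
qed

lemma X_F:
  assumes "v \<in> F_space X \<phi> n"
  shows "v \<in> dom (X i) \<and> the (X i v) \<in> F_space X \<phi> (Suc n)"
proof -
  note L = linear_operator_domD[OF linX[of i]]
  have "v \<in> span (vac_word ` {w. length w \<le> n})" using assms by (simp add: F_space_span)
  then show ?thesis
  proof (induction rule: span_induct_alt)
    case base
    then show ?case using L(1,4) by (simp add: subspace_0 subspace_F)
  next
    case (step c x y)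
    then obtain w where w: "length w \<le> n" "x = vac_word w" by blast
    have x: "x \<in> dom (X i)" "the (X i x) \<in> F_space X \<phi> (Suc n)"
      using w by (auto simp: X_W F_space_span intro!: span_base)
    have cx: "c *\<^sub>R x \<in> dom (X i)" using x L(1) by (simp add: subspace_scale)
    show ?case
      using x cx step.IH L(2)[OF cx, of y] L(3)[OF x(1), of c]
      by (simp add: subspace_add[OF L(1)] subspace_add[OF subspace_F] subspace_scale[OF subspace_F])
  qed
qed

lemma cyclic_dom: "cyclic_space X \<phi> \<subseteq> dom (X i)"
proof
  fix v assume "v \<in> cyclic_space X \<phi>"
  then obtain n where "v \<in> F_space X \<phi> n" unfolding cyclic_Union by blast
  then show "v \<in> dom (X i)" using X_F by simp
qed

lemma X_sym:
  "u \<in> cyclic_space X \<phi> \<Longrightarrow> v \<in> cyclic_space X \<phi> \<Longrightarrow> the (X i u) \<bullet> v = u \<bullet> the (X i v)"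
  using symX[of i] subsetD[OF cyclic_dom[of i]] by (simp add: symmetric_operator_def)

lemma G_F: "v \<in> G_space X \<phi> (int n) \<Longrightarrow> v \<in> F_space X \<phi> n"
  by (simp add: G_space_def split: if_splits)

lemma G_orth: "v \<in> G_space X \<phi> (int n) \<Longrightarrow> m < n \<Longrightarrow> u \<in> F_space X \<phi> m \<Longrightarrow> u \<bullet> v = 0"
  using subsetD[OF F_mono[of m "n - 1"], of u]
  by (simp add: G_space_def orthogonal_comp_def orthogonal_def split: if_splits)

lemma subspace_G: "subspace (G_space X \<phi> k)"
  by (simp add: G_space_def subspace_F subspace_inter subspace_orthogonal_comp)

text \<open>\<open>Q n\<close> is the orthogonal projection onto \<open>G\<^sub>n\<close>.\<close>

lemma graded_projections:
  obtains Q :: "nat \<Rightarrow> 'a \<Rightarrow> 'a"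
  where "\<And>n. linear (Q n)" "\<And>n x. Q n x \<in> G_space X \<phi> (int n)"
    "\<And>n x. x \<in> F_space X \<phi> n \<Longrightarrow> (\<Sum>k\<le>n. Q k x) = x"
    "\<And>n m x. x \<in> F_space X \<phi> n \<Longrightarrow> n < m \<Longrightarrow> Q m x = 0"
    "\<And>n x. x \<in> G_space X \<phi> (int n) \<Longrightarrow> Q n x = x"
    "\<And>n k x. x \<in> G_space X \<phi> (int n) \<Longrightarrow> k \<noteq> n \<Longrightarrow> Q k x = 0"
    "\<And>n x. \<forall>u\<in>F_space X \<phi> n. x \<bullet> u = 0 \<Longrightarrow> Q n x = 0"
proof -
  have "\<exists>P. linear P \<and> (\<forall>x. P x \<in> F_space X \<phi> n) \<and>
      (\<forall>x. \<forall>u\<in>F_space X \<phi> n. (x - P x) \<bullet> u = 0)" for n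
    using orthogonal_projection_exists[of "vac_word ` {w. length w \<le> n}"] finite_words
    unfolding F_space_span by (metis finite_imageI)
  then obtain P where P: "\<And>n. linear (P n)" "\<And>n x. P n x \<in> F_space X \<phi> n"
      "\<And>n x u. u \<in> F_space X \<phi> n \<Longrightarrow> (x - P n x) \<bullet> u = 0"
    by metis
  have P_eq: "P n x = y" if "y \<in> F_space X \<phi> n" "\<And>u. u \<in> F_space X \<phi> n \<Longrightarrow> (x - y) \<bullet> u = 0" for n x y
  proof -
    have d: "P n x - y \<in> F_space X \<phi> n" by (intro subspace_diff subspace_F P that)
    have "(P n x - y) \<bullet> (P n x - y) = (x - y) \<bullet> (P n x - y) - (x - P n x) \<bullet> (P n x - y)"
      by (simp add: inner_diff_left)
    then have "(P n x - y) \<bullet> (P n x - y) = 0" using P(3)[OF d] that(2)[OF d] by simp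
    then show ?thesis by simp
  qed
  have P_id: "x \<in> F_space X \<phi> n \<Longrightarrow> P n x = x" for x n by (rule P_eq) auto
  have P_0: "(\<And>u. u \<in> F_space X \<phi> n \<Longrightarrow> x \<bullet> u = 0) \<Longrightarrow> P n x = 0" for x n
    by (rule P_eq) (auto simp: subspace_0 subspace_F)
  define Q where "Q n = (case n of 0 \<Rightarrow> P 0 | Suc m \<Rightarrow> (\<lambda>x. P (Suc m) x - P m x))" for n
  have Qsum: "(\<Sum>k\<le>n. Q k x) = P n x" for n x by (induction n) (simp_all add: Q_def)
  have Qlin: "linear (Q n)" for n
    by (cases n) (auto simp: Q_def P linear_compose_sub)
  have QG: "Q n x \<in> G_space X \<phi> (int n)" for n x
  proof (cases n)
    case 0 then show ?thesis by (simp add: Q_def G_space_def P)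
  next
    case (Suc m)
    have "P (Suc m) x - P m x \<in> F_space X \<phi> (Suc m)"
      using P(2)[of m x] F_mono[of m "Suc m"] by (intro subspace_diff subspace_F P) auto
    moreover have "u \<bullet> (P (Suc m) x - P m x) = 0" if u: "u \<in> F_space X \<phi> m" for u
    proof -
      have "u \<in> F_space X \<phi> (Suc m)" using u F_mono[of m "Suc m"] by auto
      then show ?thesis using P(3)[OF u, of x] P(3)[of u "Suc m" x]
        by (simp add: inner_diff_left inner_diff_right inner_commute)
    qed
    moreover have "nat (1 + int m) = Suc m" "\<not> 1 + int m < 0" "1 + int m \<noteq> 0" by auto
    ultimately show ?thesis
      using Suc by (simp add: Q_def G_space_def orthogonal_comp_def orthogonal_def)
  qed
  have Q_0: "Q n x = 0" if "\<And>u. u \<in> F_space X \<phi> n \<Longrightarrow> x \<bullet> u = 0" for n x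
  proof (cases n)
    case 0 then show ?thesis using P_0[of n x] that by (simp add: Q_def)
  next
    case (Suc m)
    then show ?thesis using P_0[of n x] P_0[of m x] that F_mono[of m n] by (auto simp: Q_def)
  qed
  have Q_big: "Q m x = 0" if x: "x \<in> F_space X \<phi> n" "n < m" for m n x
  proof -
    obtain k where k: "m = Suc k" "n \<le> k" using x by (cases m) auto
    then have "x \<in> F_space X \<phi> k" "x \<in> F_space X \<phi> (Suc k)"
      using x F_mono[of n k] F_mono[of n "Suc k"] by auto
    then show ?thesis by (simp add: Q_def k P_id)
  qed
  have Q_small: "Q k x = 0" if "x \<in> G_space X \<phi> (int n)" "k \<noteq> n" for k n x
  proof (cases "k < n")
    case True then show ?thesis using G_orth[OF that(1) True] by (intro Q_0) (simp add: inner_commute)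
  next
    case False then show ?thesis using Q_big[OF G_F[OF that(1)], of k] that(2) by simp
  qed
  have Q_id: "Q n x = x" if x: "x \<in> G_space X \<phi> (int n)" for n x
  proof -
    have "x = (\<Sum>k\<le>n. Q k x)" using Qsum P_id[OF G_F[OF x]] by simp
    also have "\<dots> = (\<Sum>k\<le>n. if k = n then Q n x else 0)"
      by (intro sum.cong) (auto simp: Q_small[OF x])
    finally show ?thesis by simp
  qed
  show ?thesis
    by (rule that[of Q]) (use Qlin QG Qsum P_id Q_big Q_id Q_small Q_0 in auto)
qed

lemma quantum_decomposition_exists: "\<exists>am a0 ap. is_quantum_decomposition X \<phi> i am a0 ap"
proof -
  obtain Q :: "nat \<Rightarrow> 'a \<Rightarrow> 'a" where Q: "\<And>n. linear (Q n)" "\<And>n x. Q n x \<in> G_space X \<phi> (int n)"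
    "\<And>n x. x \<in> F_space X \<phi> n \<Longrightarrow> (\<Sum>k\<le>n. Q k x) = x"
    "\<And>n m x. x \<in> F_space X \<phi> n \<Longrightarrow> n < m \<Longrightarrow> Q m x = 0"
    "\<And>n x. x \<in> G_space X \<phi> (int n) \<Longrightarrow> Q n x = x"
    "\<And>n k x. x \<in> G_space X \<phi> (int n) \<Longrightarrow> k \<noteq> n \<Longrightarrow> Q k x = 0"
    "\<And>n x. \<forall>u\<in>F_space X \<phi> n. x \<bullet> u = 0 \<Longrightarrow> Q n x = 0"
    by (rule graded_projections) blast
  let ?E = "cyclic_space X \<phi>"
  define A where "A v = the (X i v)" for v
  define T where "T R v = (\<Sum>n | Q n v \<noteq> 0. R n (A (Q n v)))" for R :: "nat \<Rightarrow> 'a \<Rightarrow> 'a" and v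
  note L = linear_operator_domD[OF linX[of i]]
  have QF: "Q n v \<in> F_space X \<phi> n" for n v using G_F Q(2) by blast
  have Qdom: "Q n v \<in> dom (X i)" for n v using X_F QF by blast
  have A0: "A 0 = 0" by (simp add: A_def L(4))
  have A_add: "A (Q n x + Q n y) = A (Q n x) + A (Q n y)" for n x y
    by (simp add: A_def L(2) Qdom)
  have A_scale: "A (c *\<^sub>R Q n x) = c *\<^sub>R A (Q n x)" for n x c
    by (simp add: A_def L(3) Qdom)
  have T_eq: "T R v = (\<Sum>n\<le>N. R n (A (Q n v)))"
    if R: "\<And>n. linear (R n)" and v: "v \<in> F_space X \<phi> N" for R v N
  proof -
    have "{n. Q n v \<noteq> 0} \<subseteq> {..N}" using Q(4)[OF v] by (auto simp: not_le[symmetric])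
    then show ?thesis unfolding T_def
      by (intro sum.mono_neutral_left) (auto simp: A0 linear_0[OF R])
  qed
  define op where "op R = (\<lambda>v. if v \<in> ?E then Some (T R v) else None)" for R :: "nat \<Rightarrow> 'a \<Rightarrow> 'a"
  have dom_op: "dom (op R) = ?E" for R by (auto simp: op_def dom_def)
  have op_lin: "linear_operator (op R)" if R: "\<And>n. linear (R n)" for R
  proof -
    have "T R (x + y) = T R x + T R y" if "x \<in> ?E" "y \<in> ?E" for x y
    proof -
      obtain m n where "x \<in> F_space X \<phi> m" "y \<in> F_space X \<phi> n"
        using \<open>x \<in> ?E\<close> \<open>y \<in> ?E\<close> unfolding cyclic_Union by blast
      then have xy: "x \<in> F_space X \<phi> (max m n)" "y \<in> F_space X \<phi> (max m n)"
        using F_mono[of m "max m n"] F_mono[of n "max m n"] by auto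
      then have "x + y \<in> F_space X \<phi> (max m n)" by (rule subspace_add[OF subspace_F])
      then show ?thesis
        by (simp only: T_eq[OF R] T_eq[OF R xy(1)] T_eq[OF R xy(2)] linear_add[OF Q(1)] A_add
            linear_add[OF R] sum.distrib)
    qed
    moreover have "T R (c *\<^sub>R x) = c *\<^sub>R T R x" if "x \<in> ?E" for c x
    proof -
      obtain n where x: "x \<in> F_space X \<phi> n" using \<open>x \<in> ?E\<close> unfolding cyclic_Union by blast
      then have "c *\<^sub>R x \<in> F_space X \<phi> n" by (rule subspace_scale[OF subspace_F])
      then show ?thesis
        by (simp only: T_eq[OF R] T_eq[OF R x] linear_scale[OF Q(1)] A_scale
            linear_scale[OF R] scaleR_sum_right)
    qed
    ultimately show ?thesis
      using subspace_cyclic unfolding linear_operator_def dom_op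
      by (simp add: op_def subspace_add subspace_scale)
  qed
  have T_G: "T R v = R n (A v)" if R: "\<And>n. linear (R n)" and v: "v \<in> G_space X \<phi> (int n)" for R v n
  proof -
    have "T R v = (\<Sum>k\<le>n. if k = n then R n (A v) else 0)"
      unfolding T_eq[OF R G_F[OF v]]
      by (intro sum.cong) (auto simp: Q(5)[OF v] Q(6)[OF v] A0 linear_0[OF R])
    then show ?thesis by simp
  qed
  define Rm where "Rm n = (case n of 0 \<Rightarrow> (\<lambda>x. 0) | Suc m \<Rightarrow> Q m)" for n
  have lin: "linear (Rm n)" "linear (Q n)" "linear (Q (Suc n))" for n
    by (auto simp: Rm_def Q linear_zero split: nat.split)
  have three: "A v = Rm n (A v) + Q n (A v) + Q (Suc n) (A v)"
    if v: "v \<in> G_space X \<phi> (int n)" for v n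
  proof -
    have vE: "v \<in> ?E" using G_F[OF v] unfolding cyclic_Union by blast
    have z: "Q k (A v) = 0" if "Suc k < n" for k
    proof (rule Q(7), rule ballI)
      fix u assume u: "u \<in> F_space X \<phi> k"
      then have uE: "u \<in> ?E" unfolding cyclic_Union by blast
      have "A v \<bullet> u = v \<bullet> A u" unfolding A_def using X_sym vE uE by blast
      also have "\<dots> = 0" using G_orth[OF v that, of "A u"] X_F[OF u, of i]
        by (simp add: A_def inner_commute)
      finally show "A v \<bullet> u = 0" .
    qed
    have "A v = (\<Sum>k\<le>Suc n. Q k (A v))"
      using Q(3)[of "A v" "Suc n"] X_F[OF G_F[OF v], of i] by (simp add: A_def)
    also have "\<dots> = (\<Sum>k<n. Q k (A v)) + Q n (A v) + Q (Suc n) (A v)"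
      by (simp add: lessThan_Suc_atMost[symmetric])
    also have "(\<Sum>k<n. Q k (A v)) = Rm n (A v)"
      by (cases n) (auto simp: Rm_def z intro: sum.neutral)
    finally show ?thesis .
  qed
  have dec: "X i v = Some (T Rm v + T Q v + T (\<lambda>n. Q (Suc n)) v)" if "v \<in> ?E" for v
  proof -
    obtain N where N: "v \<in> F_space X \<phi> N" using \<open>v \<in> ?E\<close> unfolding cyclic_Union by blast
    have "A v = (\<Sum>n\<le>N. A (Q n v))"
      using linear_operator_sum[OF linX[of i], of "{..N}" "\<lambda>n. Q n v"] Qdom Q(3)[OF N]
      by (simp add: A_def)
    also have "\<dots> = (\<Sum>n\<le>N. Rm n (A (Q n v)) + Q n (A (Q n v)) + Q (Suc n) (A (Q n v)))"
      by (intro sum.cong refl three Q(2))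
    also have "\<dots> = T Rm v + T Q v + T (\<lambda>n. Q (Suc n)) v"
      using T_eq[OF lin(1) N] T_eq[OF lin(2) N] T_eq[OF lin(3) N] by (simp add: sum.distrib)
    finally have "the (X i v) = T Rm v + T Q v + T (\<lambda>n. Q (Suc n)) v" by (simp add: A_def)
    moreover have "v \<in> dom (X i)" using that cyclic_dom by blast
    ultimately show ?thesis by auto
  qed
  have Rm_G: "Rm n x \<in> G_space X \<phi> (int n - 1)" for n x
    using Q(2) by (cases n) (auto simp: Rm_def G_space_def)
  have Qp_G: "Q (Suc n) x \<in> G_space X \<phi> (int n + 1)" for n x
    using Q(2)[of "Suc n" x] by (simp add: add.commute)
  have GE: "v \<in> ?E" if "v \<in> G_space X \<phi> (int n)" for v n
    using G_F[OF that] unfolding cyclic_Union by blast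
  have "is_quantum_decomposition X \<phi> i (op Rm) (op Q) (op (\<lambda>n. Q (Suc n)))"
    unfolding is_quantum_decomposition_def
  proof (intro conjI)
    show "\<forall>A\<in>{op Rm, op Q, op (\<lambda>n. Q (Suc n))}. linear_operator A \<and> dom A = ?E"
      using dom_op op_lin lin by auto
    show "\<forall>v\<in>?E. X i v = Some (the (op Rm v) + the (op Q v) + the (op (\<lambda>n. Q (Suc n)) v))"
      using dec by (simp add: op_def)
    show "\<forall>n. \<forall>v\<in>G_space X \<phi> (int n). the (op Rm v) \<in> G_space X \<phi> (int n - 1) \<and>
        the (op Q v) \<in> G_space X \<phi> (int n) \<and> the (op (\<lambda>n. Q (Suc n)) v) \<in> G_space X \<phi> (int n + 1)"
      using GE T_G[OF lin(1)] T_G[OF lin(2)] T_G[OF lin(3)] Rm_G Q(2) Qp_G by (simp add: op_def)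
  qed
  then show ?thesis by blast
qed

lemma quantum_decomposition_unique:
  assumes a: "is_quantum_decomposition X \<phi> i am a0 ap"
    and b: "is_quantum_decomposition X \<phi> i bm b0 bp"
  shows "am = bm \<and> a0 = b0 \<and> ap = bp"
proof -
  obtain Q :: "nat \<Rightarrow> 'a \<Rightarrow> 'a" where Q: "\<And>n. linear (Q n)" "\<And>n x. Q n x \<in> G_space X \<phi> (int n)"
    "\<And>n x. x \<in> F_space X \<phi> n \<Longrightarrow> (\<Sum>k\<le>n. Q k x) = x"
    "\<And>n k x. x \<in> G_space X \<phi> (int n) \<Longrightarrow> k \<noteq> n \<Longrightarrow> Q k x = 0"
    "\<And>n x. x \<in> G_space X \<phi> (int n) \<Longrightarrow> Q n x = x"
    by (rule graded_projections) blast
  let ?E = "cyclic_space X \<phi>"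
  have GE: "v \<in> ?E" if "v \<in> G_space X \<phi> (int n)" for v n
    using G_F[OF that] unfolding cyclic_Union by blast
  have on_G: "the (cm v) = (case n of 0 \<Rightarrow> 0 | Suc m \<Rightarrow> Q m (the (X i v))) \<and>
      the (c0 v) = Q n (the (X i v)) \<and> the (cp v) = Q (Suc n) (the (X i v))"
    if c: "is_quantum_decomposition X \<phi> i cm c0 cp" and v: "v \<in> G_space X \<phi> (int n)"
    for cm c0 cp v n
  proof -
    have m: "the (cm v) \<in> G_space X \<phi> (int n - 1)" and z: "the (c0 v) \<in> G_space X \<phi> (int n)"
      and p: "the (cp v) \<in> G_space X \<phi> (int (Suc n))"
      using c v by (simp_all add: is_quantum_decomposition_def add.commute)
    have s: "the (X i v) = the (cm v) + the (c0 v) + the (cp v)"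
      using c GE[OF v] by (simp add: is_quantum_decomposition_def)
    have m0: "n = 0 \<Longrightarrow> the (cm v) = 0" using m by (simp add: G_space_def)
    have mk: "Q k (the (cm v)) = (if Suc k = n then the (cm v) else 0)" for k
    proof (cases n)
      case 0 then show ?thesis using m0 by (simp add: linear_0[OF Q(1)])
    next
      case (Suc l)
      then have "the (cm v) \<in> G_space X \<phi> (int l)" using m by simp
      then show ?thesis using Q(4,5) Suc by auto
    qed
    have zk: "Q k (the (c0 v)) = (if k = n then the (c0 v) else 0)" for k
      using Q(4)[OF z] Q(5)[OF z] by simp
    have pk: "Q k (the (cp v)) = (if k = Suc n then the (cp v) else 0)" for k
      using Q(4)[OF p] Q(5)[OF p] by simp
    show ?thesis unfolding s by (cases n) (simp_all add: linear_add[OF Q(1)] mk zk pk m0)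
  qed
  have eq: "A = B" if A: "linear_operator A" "dom A = ?E" and B: "linear_operator B" "dom B = ?E"
    and AB: "\<And>n v. v \<in> G_space X \<phi> (int n) \<Longrightarrow> the (A v) = the (B v)" for A B
  proof
    fix v
    show "A v = B v"
    proof (cases "v \<in> ?E")
      case True
      then obtain N where N: "v \<in> F_space X \<phi> N" unfolding cyclic_Union by blast
      have QE: "Q n v \<in> ?E" for n using GE Q(2) by blast
      have "the (A v) = (\<Sum>n\<le>N. the (A (Q n v)))"
        using linear_operator_sum[OF A(1), of "{..N}" "\<lambda>n. Q n v"] QE A(2) Q(3)[OF N] by simp
      also have "\<dots> = (\<Sum>n\<le>N. the (B (Q n v)))" by (intro sum.cong refl AB[OF Q(2)])
      also have "\<dots> = the (B v)"
        using linear_operator_sum[OF B(1), of "{..N}" "\<lambda>n. Q n v"] QE B(2) Q(3)[OF N] by simp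
      finally have "the (A v) = the (B v)" .
      moreover have "v \<in> dom A" "v \<in> dom B" using True A(2) B(2) by simp_all
      ultimately show ?thesis by auto
    next
      case False then show ?thesis using A(2) B(2) by (metis domIff)
    qed
  qed
  have la: "linear_operator am" "dom am = ?E" "linear_operator a0" "dom a0 = ?E"
    "linear_operator ap" "dom ap = ?E"
    and lb: "linear_operator bm" "dom bm = ?E" "linear_operator b0" "dom b0 = ?E"
    "linear_operator bp" "dom bp = ?E"
    using a b by (simp_all add: is_quantum_decomposition_def)
  have "am = bm" by (rule eq[OF la(1,2) lb(1,2)]) (use on_G[OF a] on_G[OF b] in simp)
  moreover have "a0 = b0" by (rule eq[OF la(3,4) lb(3,4)]) (use on_G[OF a] on_G[OF b] in simp)
  moreover have "ap = bp" by (rule eq[OF la(5,6) lb(5,6)]) (use on_G[OF a] on_G[OF b] in simp)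
  ultimately show ?thesis by simp
qed

end

text \<open>The definite description above is therefore well defined.\<close>

theorem is_quantum_decomposition_operators:
  assumes "probability_space X \<phi>"
  shows "is_quantum_decomposition X \<phi> i
    (annihilation X \<phi> i) (preservation X \<phi> i) (creation X \<phi> i)"
proof -
  let ?P = "\<lambda>t. case t of (am, a0, ap) \<Rightarrow> is_quantum_decomposition X \<phi> i am a0 ap"
  obtain am a0 ap where d: "is_quantum_decomposition X \<phi> i am a0 ap"
    using quantum_decomposition_exists[OF assms] by blast
  have "?P (THE t. ?P t)"
  proof (rule theI[of ?P "(am, a0, ap)"])
    show "?P (am, a0, ap)" using d by simp
    show "t = (am, a0, ap)" if "?P t" for t
      using that quantum_decomposition_unique[OF assms _ d] by (cases t) auto
  qed
  then show ?thesis
    by (simp add: annihilation_def preservation_def creation_def quantum_decomposition_def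
        split_beta)
qed

end

theory Submission
  imports Defs
begin

text \<open>
  Let \<open>coupling n\<close> be the span of the pairs \<open>(w(X)\<phi>, w(Y)\<psi>)\<close> over words \<open>w\<close> of length at most \<open>n\<close>.
  It is the graph of the assignment \<open>p(X)\<phi> \<mapsto> p(Y)\<psi>\<close> on polynomials of degree at most \<open>n\<close>, which need
  not be single-valued in advance.  The operators \<open>X\<^sub>i\<close> being symmetric, \<open>\<langle>u(X)\<phi>, w(X)\<phi>\<rangle>\<close> is the moment
  of the reversal of \<open>u\<close> followed by \<open>w\<close>, so \<open>X\<close> and \<open>Y\<close> are moment equal if and only if
  every coupling preserves inner products (\<open>moment_equal_iff_isometric\<close>).

  If all couplings are isometric, their union is the graph of an isometry from \<open>\<A>\<phi>\<close> onto \<open>\<B>\<psi>\<close> that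
  respects the filtration \<open>F\<^sub>n\<close> and intertwines \<open>X\<^sub>i\<close> with \<open>Y\<^sub>i\<close>.  It therefore respects the spaces \<open>G\<^sub>n\<close>,
  intertwines the annihilation, preservation and creation operators, and hence the commutators.

  Conversely, suppose that the commutators agree and that the coupling of level \<open>n\<close> is isometric.
  Every vector of level \<open>n + 1\<close> is a vector of level \<open>n\<close> plus vectors \<open>a\<^sup>+(i)v\<close> with \<open>v \<in> G\<^sub>n\<close>, and
  what has to be shown is that the decomposition respects the coupling and that the products
  \<open>\<langle>a\<^sup>+(i)v, a\<^sup>+(j)w\<rangle>\<close> with \<open>v, w \<in> G\<^sub>n\<close> agree.  Moving \<open>a\<^sup>+(j)\<close> to the other side turns it into \<open>a\<^sup>-(j)\<close>,
  and the commutator gives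
  \<open>a\<^sup>-(j)a\<^sup>+(i)v = [a\<^sup>-(j); a\<^sup>+(i)]\<^sub>q v + q a\<^sup>+(i)a\<^sup>-(j)v\<close>.
  The first term is controlled by hypothesis, and the second involves \<open>a\<^sup>+(i)\<close> only on \<open>G\<^sub>n\<^sub>-\<^sub>1\<close>, where
  isometry at level \<open>n\<close> already determines it.  The same computation with \<open>a\<^sup>0(i)\<close> in place of
  \<open>a\<^sup>+(i)\<close> determines the preservation operators on \<open>G\<^sub>n\<close>; at \<open>n = 0\<close>, where \<open>a\<^sup>-\<close> vanishes, the
  means \<open>\<langle>X\<^sub>i\<phi>, \<phi>\<rangle>\<close> take over.  This is \<open>isometric_Suc_from_commutators\<close>.

  A real vector is sent by the \<open>q\<close>-commutator to a vector whose real part is the commutator with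
  parameter \<open>Re q\<close>, so this computation can be carried out in the real spaces with \<open>Re q\<close> for \<open>q\<close>.
\<close>

abbreviation lower :: "('d \<Rightarrow> 'a::real_inner \<rightharpoonup> 'a) \<Rightarrow> 'a \<Rightarrow> 'd \<Rightarrow> 'a \<Rightarrow> 'a" where
  "lower X \<phi> i v \<equiv> the (annihilation X \<phi> i v)"

abbreviation keep :: "('d \<Rightarrow> 'a::real_inner \<rightharpoonup> 'a) \<Rightarrow> 'a \<Rightarrow> 'd \<Rightarrow> 'a \<Rightarrow> 'a" where
  "keep X \<phi> i v \<equiv> the (preservation X \<phi> i v)"

abbreviation raise :: "('d \<Rightarrow> 'a::real_inner \<rightharpoonup> 'a) \<Rightarrow> 'a \<Rightarrow> 'd \<Rightarrow> 'a \<Rightarrow> 'a" where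
  "raise X \<phi> i v \<equiv> the (creation X \<phi> i v)"

definition real_commutator :: "real \<Rightarrow> ('a::real_vector \<rightharpoonup> 'a) \<Rightarrow> ('a \<rightharpoonup> 'a) \<Rightarrow> 'a \<Rightarrow> 'a" where
  "real_commutator c A B v = the (A (the (B v))) - c *\<^sub>R the (B (the (A v)))"

text \<open>
  Invariance of the cyclic space is what makes compositions of such partial maps defined on all
  of it, so that the \<open>q\<close>-commutator of two of them can be computed without domain conditions.
\<close>

definition cyclic_operator ::
    "('d \<Rightarrow> 'a::real_vector \<rightharpoonup> 'a) \<Rightarrow> 'a \<Rightarrow> ('a \<rightharpoonup> 'a) \<Rightarrow> bool" where
  "cyclic_operator X \<phi> A \<longleftrightarrow> linear_operator A \<and> dom A = cyclic_space X \<phi> \<and>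
     (\<forall>v\<in>cyclic_space X \<phi>. the (A v) \<in> cyclic_space X \<phi>)"

section \<open>The quantum decomposition of one random vector\<close>

context
  fixes X :: "'d::finite \<Rightarrow> 'a::{real_inner, complete_space} \<rightharpoonup> 'a" and \<phi> :: 'a
  assumes ps: "probability_space X \<phi>"
begin

lemmas decomposition = is_quantum_decomposition_operators[OF ps, unfolded is_quantum_decomposition_def]

lemma linear_operator_parts:
  "linear_operator (annihilation X \<phi> i)" "dom (annihilation X \<phi> i) = cyclic_space X \<phi>"
  "linear_operator (preservation X \<phi> i)" "dom (preservation X \<phi> i) = cyclic_space X \<phi>"
  "linear_operator (creation X \<phi> i)" "dom (creation X \<phi> i) = cyclic_space X \<phi>"
  using decomposition[of i] by simp_all

lemma F_cyclic: "v \<in> F_space X \<phi> n \<Longrightarrow> v \<in> cyclic_space X \<phi>"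
  unfolding cyclic_Union[OF ps] by blast

lemma G_cyclic: "v \<in> G_space X \<phi> (int n) \<Longrightarrow> v \<in> cyclic_space X \<phi>"
  using F_cyclic G_F[OF ps] by blast

lemma mult_split:
  "v \<in> cyclic_space X \<phi> \<Longrightarrow> the (X i v) = lower X \<phi> i v + keep X \<phi> i v + raise X \<phi> i v"
  using decomposition[of i] by simp

lemma lower_G_0: "v \<in> G_space X \<phi> 0 \<Longrightarrow> lower X \<phi> i v = 0"
  using conjunct2[OF conjunct2[OF decomposition[of i]], rule_format, of v 0]
  by (simp add: G_space_def)

lemma lower_G: "v \<in> G_space X \<phi> (int (Suc n)) \<Longrightarrow> lower X \<phi> i v \<in> G_space X \<phi> (int n)"
  using conjunct2[OF conjunct2[OF decomposition[of i]], rule_format, of v "Suc n"] by simp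

lemma keep_G: "v \<in> G_space X \<phi> (int n) \<Longrightarrow> keep X \<phi> i v \<in> G_space X \<phi> (int n)"
  using conjunct2[OF conjunct2[OF decomposition[of i]], rule_format, of v n] by simp

lemma raise_G: "v \<in> G_space X \<phi> (int n) \<Longrightarrow> raise X \<phi> i v \<in> G_space X \<phi> (int (Suc n))"
  using conjunct2[OF conjunct2[OF decomposition[of i]], rule_format, of v n]
  by (simp add: add.commute)

text \<open>
  The component in \<open>G\<^sub>n\<^sub>+\<^sub>1\<close> is split off by the last of the orthogonal projections; iterating this
  reduces statements about \<open>F\<^sub>n\<close> to the homogeneous spaces.
\<close>

lemma F_Suc_split:
  assumes "x \<in> F_space X \<phi> (Suc n)"
  obtains x0 x1 where "x0 \<in> G_space X \<phi> (int (Suc n))" "x1 \<in> F_space X \<phi> n" "x = x0 + x1"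
proof -
  obtain Q :: "nat \<Rightarrow> 'a \<Rightarrow> 'a" where Q: "\<And>n x. Q n x \<in> G_space X \<phi> (int n)"
    "\<And>n x. x \<in> F_space X \<phi> n \<Longrightarrow> (\<Sum>k\<le>n. Q k x) = x"
    by (rule graded_projections[OF ps]) blast
  have "(\<Sum>k\<le>n. Q k x) \<in> F_space X \<phi> n"
  proof (rule subspace_sum[OF subspace_F[OF ps]])
    fix k assume "k \<in> {..n}"
    then show "Q k x \<in> F_space X \<phi> n" using G_F[OF ps Q(1)] F_mono[OF ps, of k n] by auto
  qed
  moreover have "x = Q (Suc n) x + (\<Sum>k\<le>n. Q k x)" using Q(2)[OF assms] by (simp add: add.commute)
  ultimately show ?thesis using that Q(1) by blast
qed

lemma lower_F_0: "v \<in> F_space X \<phi> 0 \<Longrightarrow> lower X \<phi> i v = 0"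
  using lower_G_0 by (simp add: G_space_def)

lemma operator_F_subspace:
  assumes A: "linear_operator A" "dom A = cyclic_space X \<phi>" and S: "subspace S"
    and "\<And>m v. m \<le> n \<Longrightarrow> v \<in> G_space X \<phi> (int m) \<Longrightarrow> the (A v) \<in> S"
    and "v \<in> F_space X \<phi> n"
  shows "the (A v) \<in> S"
  using assms(4,5)
proof (induction n arbitrary: v)
  case 0
  then show ?case by (simp add: G_space_def)
next
  case (Suc n)
  obtain x y where xy: "x \<in> G_space X \<phi> (int (Suc n))" "y \<in> F_space X \<phi> n" "v = x + y"
    using F_Suc_split[OF Suc.prems(2)] by blast
  have "the (A x) \<in> S" using Suc.prems(1)[OF le_refl xy(1)] .
  moreover have "the (A y) \<in> S" by (rule Suc.IH[OF Suc.prems(1) xy(2)]) simp_all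
  ultimately show ?case
    using linear_operator_domD(2)[OF A(1), of x y] A(2) G_cyclic[OF xy(1)] F_cyclic[OF xy(2)]
    by (simp add: xy(3) subspace_add[OF S])
qed

lemma lower_F: "v \<in> F_space X \<phi> n \<Longrightarrow> lower X \<phi> i v \<in> F_space X \<phi> n"
proof (erule operator_F_subspace[OF linear_operator_parts(1,2) subspace_F[OF ps], rotated])
  fix m v assume m: "m \<le> n" "v \<in> G_space X \<phi> (int m)"
  show "lower X \<phi> i v \<in> F_space X \<phi> n"
  proof (cases m)
    case 0
    then show ?thesis using m lower_G_0[of v] subspace_0[OF subspace_F[OF ps]] by simp
  next
    case (Suc k)
    then show ?thesis
      using m G_F[OF ps lower_G[of v k i]] F_mono[OF ps, of k n] by auto
  qed
qed

lemma keep_F: "v \<in> F_space X \<phi> n \<Longrightarrow> keep X \<phi> i v \<in> F_space X \<phi> n"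
proof (erule operator_F_subspace[OF linear_operator_parts(3,4) subspace_F[OF ps], rotated])
  fix m v assume "m \<le> n" "v \<in> G_space X \<phi> (int m)"
  then show "keep X \<phi> i v \<in> F_space X \<phi> n"
    using G_F[OF ps keep_G[of v m i]] F_mono[OF ps, of m n] by auto
qed

lemma raise_F: "v \<in> F_space X \<phi> n \<Longrightarrow> raise X \<phi> i v \<in> F_space X \<phi> (Suc n)"
proof (erule operator_F_subspace[OF linear_operator_parts(5,6) subspace_F[OF ps], rotated])
  fix m v assume "m \<le> n" "v \<in> G_space X \<phi> (int m)"
  then show "raise X \<phi> i v \<in> F_space X \<phi> (Suc n)"
    using G_F[OF ps raise_G[of v m i]] F_mono[OF ps, of "Suc m" "Suc n"] by auto
qed

lemma cyclic_operator_parts: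
  "cyclic_operator X \<phi> (annihilation X \<phi> i)"
  "cyclic_operator X \<phi> (preservation X \<phi> i)"
  "cyclic_operator X \<phi> (creation X \<phi> i)"
  using linear_operator_parts
  by (auto simp: cyclic_operator_def cyclic_Union[OF ps] intro: lower_F keep_F raise_F)

text \<open>
  The creation part of \<open>X\<^sub>i v\<close> has degree \<open>n + 1\<close> and is orthogonal to \<open>F\<^sub>n\<close>.
\<close>

lemma inner_mult_G:
  assumes v: "v \<in> G_space X \<phi> (int n)" and t: "t \<in> F_space X \<phi> n"
  shows "the (X i v) \<bullet> t = lower X \<phi> i v \<bullet> t + keep X \<phi> i v \<bullet> t"
  using G_orth[OF ps raise_G[OF v] _ t, of i]
  by (simp add: mult_split[OF G_cyclic[OF v]] inner_add_left inner_commute[of t])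

text \<open>
  On the top degree annihilation acts as the adjoint of multiplication: tested against degree at most
  \<open>n\<close>, the other two parts of \<open>X\<^sub>i v\<close> vanish by orthogonality.  This is how a letter is moved from one
  side of an inner product to the other.
\<close>

lemma inner_lower:
  assumes v: "v \<in> G_space X \<phi> (int (Suc n))" and t: "t \<in> F_space X \<phi> n"
  shows "lower X \<phi> i v \<bullet> t = v \<bullet> the (X i t)"
proof -
  have tS: "t \<in> F_space X \<phi> (Suc n)" using t F_mono[OF ps, of n "Suc n"] by auto
  have "keep X \<phi> i v \<bullet> t = 0"
    using G_orth[OF ps keep_G[OF v] _ t] by (simp add: inner_commute)
  then show ?thesis
    using inner_mult_G[OF v tS] X_sym[OF ps G_cyclic[OF v] F_cyclic[OF t], of i] by simp
qed

lemma vacuum: "vac_word X \<phi> [] = \<phi>" "the (X i \<phi>) = vac_word X \<phi> [i]" "\<phi> \<in> F_space X \<phi> n"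
  "\<phi> \<bullet> \<phi> = 1"
proof -
  show v: "vac_word X \<phi> [] = \<phi>" by (simp add: vac_word_def[OF ps])
  show "the (X i \<phi>) = vac_word X \<phi> [i]" using X_W[OF ps, of i "[]"] v by simp
  show "\<phi> \<in> F_space X \<phi> n"
    unfolding F_space_span[OF ps] using v by (intro span_base image_eqI[of _ _ "[]"]) auto
  show "\<phi> \<bullet> \<phi> = 1" using ps by (simp add: probability_space_def norm_eq_1)
qed

lemma vac_word_F: "length w \<le> n \<Longrightarrow> vac_word X \<phi> w \<in> F_space X \<phi> n"
  unfolding F_space_span[OF ps] by (intro span_base) auto

lemma vac_word_inner: "vac_word X \<phi> u \<bullet> vac_word X \<phi> w = vac_word X \<phi> (rev u @ w) \<bullet> \<phi>"
proof (induction u arbitrary: w)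
  case Nil
  then show ?case by (simp add: vacuum inner_commute)
next
  case (Cons i u)
  have "vac_word X \<phi> (i # u) \<bullet> vac_word X \<phi> w = the (X i (vac_word X \<phi> u)) \<bullet> vac_word X \<phi> w"
    by (simp add: X_W[OF ps])
  also have "\<dots> = vac_word X \<phi> u \<bullet> the (X i (vac_word X \<phi> w))"
    by (rule X_sym[OF ps]) (rule F_cyclic, rule vac_word_F, rule le_refl)+
  also have "\<dots> = vac_word X \<phi> u \<bullet> vac_word X \<phi> (i # w)"
    by (simp add: X_W[OF ps])
  finally show ?case using Cons.IH by simp
qed

text \<open>
  On a real vector both products are real, and multiplication by \<open>q\<close> creates the only imaginary part.
\<close>

lemma q_commutator_real_vector:
  assumes A: "cyclic_operator X \<phi> A" and B: "cyclic_operator X \<phi> B"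
    and v: "v \<in> cyclic_space X \<phi>"
  shows "q_commutator q A B (v, 0) =
    Some (real_commutator (Re q) A B v, - (Im q *\<^sub>R the (B (the (A v)))))"
proof -
  have z: "(0::'a) \<in> cyclic_space X \<phi>" using subspace_0[OF subspace_cyclic[OF ps]] .
  have "linear_operator A" "linear_operator B" using A B by (simp_all add: cyclic_operator_def)
  then have "the (A 0) = 0" "the (B 0) = 0" by (simp_all add: linear_operator_domD(4))
  then show ?thesis
    using A B v z
    by (simp add: q_commutator_def complexify_def map_comp_def dom_def cscale_def
        real_commutator_def Let_def cyclic_operator_def set_eq_iff)
qed

text \<open>
  Words applied to the vacuum are real vectors, so real and imaginary parts of the coefficients
  separate.  Summing over all short words makes the index set independent of the polynomial.
\<close>

lemma cpoly_vec_parts: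
  assumes "deg_le n r"
  shows "cpoly_vec X r \<phi> =
    ((\<Sum>w | length w \<le> n. Re (Poly_Mapping.lookup r w) *\<^sub>R vac_word X \<phi> w),
     (\<Sum>w | length w \<le> n. Im (Poly_Mapping.lookup r w) *\<^sub>R vac_word X \<phi> w))"
proof -
  have "cpoly_vec X r \<phi> =
      (\<Sum>w | length w \<le> n. cscale (Poly_Mapping.lookup r w) (vac_word X \<phi> w, 0))"
    unfolding cpoly_vec_def vac_word_def[OF ps]
    using assms finite_words[OF ps]
    by (intro sum.mono_neutral_left) (auto simp: deg_le_def in_keys_iff cscale_def zero_prod_def)
  then show ?thesis by (simp add: cscale_def sum_prod)
qed

end


lemma ncpoly_of_coefficients:
  fixes c :: "'d::finite list \<Rightarrow> 'c::zero"
  obtains p :: "('d, 'c) ncpoly" where "deg_le n p"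
    "\<And>w. Poly_Mapping.lookup p w = (if length w \<le> n then c w else 0)"
proof -
  let ?f = "\<lambda>w. if length w \<le> n then c w else 0"
  have "finite {w::'d list. length w \<le> n}"
    using finite_lists_length_le[of "UNIV :: 'd set" n] by simp
  then have "finite {w. ?f w \<noteq> 0}" by (rule rev_finite_subset) auto
  then have l: "Poly_Mapping.lookup (Abs_poly_mapping ?f) = ?f" by (rule lookup_Abs_poly_mapping)
  show ?thesis
    by (rule that[of "Abs_poly_mapping ?f"]) (auto simp: l deg_le_def in_keys_iff split: if_splits)
qed

section \<open>The coupling of two random vectors\<close>

context
  fixes X :: "'d::finite \<Rightarrow> 'a::{real_inner, complete_space} \<rightharpoonup> 'a" and \<phi> :: 'a
    and Y :: "'d \<Rightarrow> 'b::{real_inner, complete_space} \<rightharpoonup> 'b" and \<psi> :: 'b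
  assumes pX: "probability_space X \<phi>" and pY: "probability_space Y \<psi>"
begin

text \<open>
  A subspace of pairs instead of a map, because \<open>p(X)\<phi> = r(X)\<phi>\<close> need not give \<open>p(Y)\<psi> = r(Y)\<psi>\<close> before
  isometry is known.
\<close>

definition coupling :: "nat \<Rightarrow> ('a \<times> 'b) set" where
  "coupling n = span ((\<lambda>w. (vac_word X \<phi> w, vac_word Y \<psi> w)) ` {w. length w \<le> n})"

definition graded_coupling :: "nat \<Rightarrow> ('a \<times> 'b) set" where
  "graded_coupling n = coupling n \<inter> G_space X \<phi> (int n) \<times> G_space Y \<psi> (int n)"

definition isometric_coupling :: "nat \<Rightarrow> bool" where
  "isometric_coupling n \<longleftrightarrow>
     (\<forall>(v, v')\<in>coupling n. \<forall>(w, w')\<in>coupling n. v \<bullet> w = v' \<bullet> w')"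

lemma subspace_coupling: "subspace (coupling n)"
  by (simp add: coupling_def)

lemma coupling_mono: "m \<le> n \<Longrightarrow> z \<in> coupling m \<Longrightarrow> z \<in> coupling n"
  unfolding coupling_def by (erule subsetD[OF span_mono, rotated]) auto

lemma coupling_word: "length w \<le> n \<Longrightarrow> (vac_word X \<phi> w, vac_word Y \<psi> w) \<in> coupling n"
  unfolding coupling_def by (intro span_base) auto

lemma coupling_vacuum: "(\<phi>, \<psi>) \<in> coupling n"
  using coupling_word[of "[]" n] by (simp add: vacuum(1)[OF pX] vacuum(1)[OF pY])

lemma coupling_scale: "(v, v') \<in> coupling n \<Longrightarrow> (c *\<^sub>R v, c *\<^sub>R v') \<in> coupling n"
  using subspace_scale[OF subspace_coupling] by fastforce

lemma coupling_coefficients: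
  "(v, v') \<in> coupling n \<longleftrightarrow>
    (\<exists>c. v = (\<Sum>w | length w \<le> n. c w *\<^sub>R vac_word X \<phi> w) \<and>
         v' = (\<Sum>w | length w \<le> n. c w *\<^sub>R vac_word Y \<psi> w))"
  (is "_ \<longleftrightarrow> (\<exists>c. v = ?s c \<and> v' = ?t c)")
proof
  assume "(v, v') \<in> coupling n"
  then have "\<exists>c. (v, v') = (?s c, ?t c)"
    unfolding coupling_def
  proof (induction rule: span_induct_alt)
    case base
    show ?case by (rule exI[of _ "\<lambda>_. 0"]) (simp add: zero_prod_def)
  next
    case (step a x y)
    then obtain u c where u: "length u \<le> n" "x = (vac_word X \<phi> u, vac_word Y \<psi> u)"
      and c: "y = (?s c, ?t c)" by blast
    have d: "(\<Sum>w | length w \<le> n. (if w = u then a else 0) *\<^sub>R f w) = a *\<^sub>R f u"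
      for f :: "'d list \<Rightarrow> 'e::real_vector"
      using u(1) finite_words[OF pX, of n]
      by (simp add: if_distrib[of "\<lambda>b. b *\<^sub>R _"] sum.delta cong: if_cong)
    show ?case
      by (rule exI[of _ "\<lambda>w. (if w = u then a else 0) + c w"])
        (simp only: u(2) c scaleR_add_left sum.distrib d, simp)
  qed
  then show "\<exists>c. v = ?s c \<and> v' = ?t c" by simp
next
  assume "\<exists>c. v = ?s c \<and> v' = ?t c"
  then obtain c where "(v, v') =
      (\<Sum>w | length w \<le> n. c w *\<^sub>R (vac_word X \<phi> w, vac_word Y \<psi> w))"
    by (auto simp: sum_prod)
  then show "(v, v') \<in> coupling n"
    by (auto intro!: subspace_sum coupling_scale subspace_coupling coupling_word)
qed

lemma coupling_poly:
  "(v, v') \<in> coupling n \<longleftrightarrow>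
    (\<exists>p. deg_le n p \<and> v = the (poly_op X p \<phi>) \<and> v' = the (poly_op Y p \<psi>))"
proof
  assume "(v, v') \<in> coupling n"
  then obtain c where c: "v = (\<Sum>w | length w \<le> n. c w *\<^sub>R vac_word X \<phi> w)"
    "v' = (\<Sum>w | length w \<le> n. c w *\<^sub>R vac_word Y \<psi> w)"
    unfolding coupling_coefficients by blast
  obtain p where p: "deg_le n p"
    "\<And>w. Poly_Mapping.lookup p w = (if length w \<le> n then c w else 0)"
    by (rule ncpoly_of_coefficients[of n c]) (rule that)
  have "v = the (poly_op X p \<phi>)" "v' = the (poly_op Y p \<psi>)"
    by (auto simp: c poly_vac_deg_le[OF pX p(1)] poly_vac_deg_le[OF pY p(1)] p(2) intro!: sum.cong)
  then show "\<exists>p. deg_le n p \<and> v = the (poly_op X p \<phi>) \<and> v' = the (poly_op Y p \<psi>)"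
    using p(1) by blast
next
  assume "\<exists>p. deg_le n p \<and> v = the (poly_op X p \<phi>) \<and> v' = the (poly_op Y p \<psi>)"
  then show "(v, v') \<in> coupling n"
    unfolding coupling_coefficients by (auto simp: poly_vac_deg_le[OF pX] poly_vac_deg_le[OF pY])
qed

lemma coupling_F: "(v, v') \<in> coupling n \<Longrightarrow> v \<in> F_space X \<phi> n \<and> v' \<in> F_space Y \<psi> n"
  by (auto simp: coupling_poly F_space_def)

lemma coupling_total_left: "v \<in> F_space X \<phi> n \<Longrightarrow> \<exists>v'. (v, v') \<in> coupling n"
  by (auto simp: coupling_poly F_space_def)

lemma coupling_total_right: "v' \<in> F_space Y \<psi> n \<Longrightarrow> \<exists>v. (v, v') \<in> coupling n"
  by (auto simp: coupling_poly F_space_def)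

lemma coupling_cyclic:
  "(v, v') \<in> coupling n \<Longrightarrow> v \<in> cyclic_space X \<phi> \<and> v' \<in> cyclic_space Y \<psi>"
  using coupling_F[of v v' n] F_cyclic[OF pX] F_cyclic[OF pY] by auto

lemma coupling_add:
  "(v, v') \<in> coupling n \<Longrightarrow> (w, w') \<in> coupling n \<Longrightarrow> (v + w, v' + w') \<in> coupling n"
  using subspace_add[OF subspace_coupling] by fastforce

lemma coupling_diff:
  "(v, v') \<in> coupling n \<Longrightarrow> (w, w') \<in> coupling n \<Longrightarrow> (v - w, v' - w') \<in> coupling n"
  using subspace_diff[OF subspace_coupling] by fastforce

lemma coupling_0: "(0, 0) \<in> coupling n"
  using subspace_0[OF subspace_coupling] by (simp add: zero_prod_def)

lemma coupling_mult:
  assumes "(v, v') \<in> coupling n"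
  shows "(the (X i v), the (Y i v')) \<in> coupling (Suc n)"
proof -
  obtain c where c: "v = (\<Sum>w | length w \<le> n. c w *\<^sub>R vac_word X \<phi> w)"
    "v' = (\<Sum>w | length w \<le> n. c w *\<^sub>R vac_word Y \<psi> w)"
    using assms unfolding coupling_coefficients by blast
  have mult_sum: "the (Z i (\<Sum>w | length w \<le> n. c w *\<^sub>R vac_word Z \<zeta> w)) =
      (\<Sum>w | length w \<le> n. c w *\<^sub>R vac_word Z \<zeta> (i # w))"
    if pZ: "probability_space Z \<zeta>" for Z :: "'d \<Rightarrow> 'e::{real_inner, complete_space} \<rightharpoonup> 'e" and \<zeta>
  proof -
    note L = linear_operator_domD[OF linX[OF pZ, of i]]
    have d: "vac_word Z \<zeta> w \<in> dom (Z i)" for w by (simp add: X_W[OF pZ] dom_def)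
    then have d': "c w *\<^sub>R vac_word Z \<zeta> w \<in> dom (Z i)" for w by (rule subspace_scale[OF L(1)])
    have e: "the (Z i (c w *\<^sub>R vac_word Z \<zeta> w)) = c w *\<^sub>R vac_word Z \<zeta> (i # w)" for w
      by (simp add: L(3)[OF d] X_W[OF pZ])
    show ?thesis
      using linear_operator_sum[OF linX[OF pZ] finite_words[OF pX], where f = "\<lambda>w. c w *\<^sub>R vac_word Z \<zeta> w"] d' e
      by simp
  qed
  have "(the (X i v), the (Y i v')) =
      (\<Sum>w | length w \<le> n. c w *\<^sub>R (vac_word X \<phi> (i # w), vac_word Y \<psi> (i # w)))"
    by (simp add: c mult_sum[OF pX] mult_sum[OF pY] sum_prod)
  then show ?thesis
    by (auto intro!: subspace_sum coupling_scale subspace_coupling coupling_word)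
qed

lemma isometricD:
  "isometric_coupling n \<Longrightarrow> (v, v') \<in> coupling n \<Longrightarrow> (w, w') \<in> coupling n \<Longrightarrow> v \<bullet> w = v' \<bullet> w'"
  unfolding isometric_coupling_def by blast

lemma isometric_coupling_mono:
  assumes "isometric_coupling n" "m \<le> n"
  shows "isometric_coupling m"
  unfolding isometric_coupling_def[of m]
  by (auto intro!: isometricD[OF assms(1)] coupling_mono[OF assms(2)])

lemma isometric_coupling_words:
  assumes "\<And>u w. length u \<le> n \<Longrightarrow> length w \<le> n \<Longrightarrow>
    vac_word X \<phi> u \<bullet> vac_word X \<phi> w = vac_word Y \<psi> u \<bullet> vac_word Y \<psi> w"
  shows "isometric_coupling n"
proof -
  have "v \<bullet> w = v' \<bullet> w'" if "(v, v') \<in> coupling n" "(w, w') \<in> coupling n" for v v' w w'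
    using that unfolding coupling_coefficients
    by (auto simp: inner_sum_left inner_sum_right assms intro!: sum.cong)
  then show ?thesis unfolding isometric_coupling_def by blast
qed

text \<open>
  A product of two words applied to the vacuum is a single moment, by \<open>vac_word_inner\<close>; conversely a
  moment is the inner product of a vector with the vacuum.
\<close>

lemma moment_equal_iff_isometric: "moment_equal X \<phi> Y \<psi> \<longleftrightarrow> (\<forall>n. isometric_coupling n)"
proof
  assume m: "moment_equal X \<phi> Y \<psi>"
  have "vac_word X \<phi> w \<bullet> \<phi> = vac_word Y \<psi> w \<bullet> \<psi>" for w
    using m[unfolded moment_equal_def, THEN spec, of "Poly_Mapping.single w 1"]
    by (simp add: expectation_def poly_vac[OF pX] poly_vac[OF pY])
  then show "\<forall>n. isometric_coupling n"
    by (auto intro!: isometric_coupling_words simp: vac_word_inner[OF pX] vac_word_inner[OF pY])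
next
  assume g: "\<forall>n. isometric_coupling n"
  have "the (poly_op X p \<phi>) \<bullet> \<phi> = the (poly_op Y p \<psi>) \<bullet> \<psi>" for p
  proof -
    have "deg_le (Max (length ` Poly_Mapping.keys p)) p" by (auto simp: deg_le_def)
    then have "(the (poly_op X p \<phi>), the (poly_op Y p \<psi>)) \<in>
        coupling (Max (length ` Poly_Mapping.keys p))"
      unfolding coupling_poly by blast
    then show ?thesis using isometricD[OF g[rule_format] _ coupling_vacuum] by blast
  qed
  then show "moment_equal X \<phi> Y \<psi>" by (simp add: moment_equal_def expectation_def)
qed

text \<open>
  Translates equality of commutators into closure of the couplings: the real and imaginary coefficients
  of the common polynomial \<open>r\<close> represent the real and imaginary components of the value.  For real \<open>q\<close>
  the imaginary component is zero, which allows \<open>r\<close> to be chosen real.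
\<close>

lemma same_action_q_commutator_iff:
  assumes A: "cyclic_operator X \<phi> A" "cyclic_operator Y \<psi> A'"
    and B: "cyclic_operator X \<phi> B" "cyclic_operator Y \<psi> B'"
  shows "same_action q X \<phi> Y \<psi> (q_commutator q A B) (q_commutator q A' B') \<longleftrightarrow>
    (\<forall>n. \<forall>(v, v')\<in>coupling n.
      (real_commutator (Re q) A B v, real_commutator (Re q) A' B' v') \<in> coupling n \<and>
      (Im q *\<^sub>R the (B (the (A v))), Im q *\<^sub>R the (B' (the (A' v')))) \<in> coupling n)"
    (is "?L \<longleftrightarrow> (\<forall>n. \<forall>(v, v')\<in>coupling n. ?R n v v')")
proof
  assume L: ?L
  show "\<forall>n. \<forall>(v, v')\<in>coupling n. ?R n v v'"
  proof (intro allI ballI, clarify)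
    fix n v v' assume v: "(v, v') \<in> coupling n"
    then obtain p where p: "deg_le n p" "v = the (poly_op X p \<phi>)" "v' = the (poly_op Y p \<psi>)"
      unfolding coupling_poly by blast
    then obtain r where r: "deg_le n r" "q_commutator q A B (v, 0) = Some (cpoly_vec X r \<phi>)"
      "q_commutator q A' B' (v', 0) = Some (cpoly_vec Y r \<psi>)"
      using L[unfolded same_action_def, rule_format, OF p(1)] by blast
    have vE: "v \<in> cyclic_space X \<phi>" "v' \<in> cyclic_space Y \<psi>" using coupling_cyclic[OF v] by simp_all
    note e = r(2)[unfolded q_commutator_real_vector[OF pX A(1) B(1) vE(1)] cpoly_vec_parts[OF pX r(1)]]
      r(3)[unfolded q_commutator_real_vector[OF pY A(2) B(2) vE(2)] cpoly_vec_parts[OF pY r(1)]]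
    have "(real_commutator (Re q) A B v, real_commutator (Re q) A' B' v') \<in> coupling n"
      unfolding coupling_coefficients using e
      by (intro exI[of _ "\<lambda>w. Re (Poly_Mapping.lookup r w)"]) simp
    moreover have "(- (Im q *\<^sub>R the (B (the (A v)))), - (Im q *\<^sub>R the (B' (the (A' v'))))) \<in> coupling n"
      unfolding coupling_coefficients using e
      by (intro exI[of _ "\<lambda>w. Im (Poly_Mapping.lookup r w)"]) simp
    ultimately show "?R n v v'" using coupling_scale[of _ _ n "-1"] by fastforce
  qed
next
  assume R: "\<forall>n. \<forall>(v, v')\<in>coupling n. ?R n v v'"
  show ?L
    unfolding same_action_def
  proof (intro allI impI)
    fix n and p :: "('d, real) ncpoly" assume p: "deg_le n p"
    define v v' where "v = the (poly_op X p \<phi>)" and "v' = the (poly_op Y p \<psi>)"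
    have v: "(v, v') \<in> coupling n" unfolding v_def v'_def coupling_poly using p by blast
    have vE: "v \<in> cyclic_space X \<phi>" "v' \<in> cyclic_space Y \<psi>" using coupling_cyclic[OF v] by simp_all
    have Rv: "?R n v v'" using bspec[OF spec[OF R] v] by simp
    obtain c where c:
      "real_commutator (Re q) A B v = (\<Sum>w | length w \<le> n. c w *\<^sub>R vac_word X \<phi> w)"
      "real_commutator (Re q) A' B' v' = (\<Sum>w | length w \<le> n. c w *\<^sub>R vac_word Y \<psi> w)"
      using Rv unfolding coupling_coefficients by blast
    have "\<exists>d. - (Im q *\<^sub>R the (B (the (A v)))) = (\<Sum>w | length w \<le> n. d w *\<^sub>R vac_word X \<phi> w) \<and>
        - (Im q *\<^sub>R the (B' (the (A' v')))) = (\<Sum>w | length w \<le> n. d w *\<^sub>R vac_word Y \<psi> w) \<and>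
        (q \<in> \<real> \<longrightarrow> d = (\<lambda>_. 0))"
    proof (cases "q \<in> \<real>")
      case True
      then show ?thesis by (intro exI[of _ "\<lambda>_. 0"]) (simp add: complex_is_Real_iff)
    next
      case False
      have "(- (Im q *\<^sub>R the (B (the (A v)))), - (Im q *\<^sub>R the (B' (the (A' v'))))) \<in> coupling n"
        using Rv coupling_scale[of _ _ n "-1"] by fastforce
      then show ?thesis using False unfolding coupling_coefficients by blast
    qed
    then obtain d where d:
      "- (Im q *\<^sub>R the (B (the (A v)))) = (\<Sum>w | length w \<le> n. d w *\<^sub>R vac_word X \<phi> w)"
      "- (Im q *\<^sub>R the (B' (the (A' v')))) = (\<Sum>w | length w \<le> n. d w *\<^sub>R vac_word Y \<psi> w)"
      "q \<in> \<real> \<longrightarrow> d = (\<lambda>_. 0)" by (elim exE conjE) (rule that)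
    obtain r where r: "deg_le n r"
      "\<And>w. Poly_Mapping.lookup r w = (if length w \<le> n then Complex (c w) (d w) else 0)"
      by (rule ncpoly_of_coefficients[of n "\<lambda>w. Complex (c w) (d w)"]) (rule that)
    have "q_commutator q A B (v, 0) = Some (cpoly_vec X r \<phi>)"
      unfolding q_commutator_real_vector[OF pX A(1) B(1) vE(1)] cpoly_vec_parts[OF pX r(1)] c d
      by (simp add: r(2))
    moreover have "q_commutator q A' B' (v', 0) = Some (cpoly_vec Y r \<psi>)"
      unfolding q_commutator_real_vector[OF pY A(2) B(2) vE(2)] cpoly_vec_parts[OF pY r(1)] c d
      by (simp add: r(2))
    moreover have "Poly_Mapping.lookup r w \<in> \<real>" if "q \<in> \<real>" for w
      by (simp add: r(2) d(3)[rule_format, OF that] complex_is_Real_iff)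
    ultimately show "\<exists>r. deg_le n r \<and> (q \<in> \<real> \<longrightarrow> (\<forall>w. Poly_Mapping.lookup r w \<in> \<real>)) \<and>
        q_commutator q A B (the (poly_op X p \<phi>), 0) = Some (cpoly_vec X r \<phi>) \<and>
        q_commutator q A' B' (the (poly_op Y p \<psi>), 0) = Some (cpoly_vec Y r \<psi>)"
      using r(1) unfolding v_def v'_def by (intro exI[of _ r] conjI impI allI)
  qed
qed

section \<open>Isometric couplings intertwine the quantum decompositions\<close>

text \<open>
  An isometric coupling is the graph of an isometry of \<open>F\<^sub>n\<close> onto \<open>F\<^sub>n\<close>, and a vector of the target is
  determined by its inner products with the images of the words.
\<close>

lemma coupling_criterion:
  assumes iso: "isometric_coupling n"
    and x: "x \<in> F_space X \<phi> n" and y: "y \<in> F_space Y \<psi> n"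
    and eq: "\<And>w. length w \<le> n \<Longrightarrow> x \<bullet> vac_word X \<phi> w = y \<bullet> vac_word Y \<psi> w"
  shows "(x, y) \<in> coupling n"
proof -
  obtain z where z: "(x, z) \<in> coupling n" using coupling_total_left[OF x] by blast
  \<comment> \<open>The partner \<open>z\<close> of \<open>x\<close> has the same products with words as \<open>y\<close>, so \<open>y - z\<close> is orthogonal to itself.\<close>
  have "y - z \<in> F_space Y \<psi> n"
    using y coupling_F[OF z] by (intro subspace_diff subspace_F[OF pY]) simp_all
  then obtain t where t: "(t, y - z) \<in> coupling n" using coupling_total_right by blast
  then obtain c where c: "t = (\<Sum>w | length w \<le> n. c w *\<^sub>R vac_word X \<phi> w)"
    "y - z = (\<Sum>w | length w \<le> n. c w *\<^sub>R vac_word Y \<psi> w)"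
    unfolding coupling_coefficients by blast
  have "x \<bullet> t = y \<bullet> (y - z)" by (simp add: c inner_sum_right eq)
  moreover have "x \<bullet> t = z \<bullet> (y - z)" by (rule isometricD[OF iso z t])
  ultimately have "(y - z) \<bullet> (y - z) = 0" by (simp add: inner_diff_left)
  then show ?thesis using z by simp
qed

text \<open>
  An isometry respecting the filtration also respects orthogonal complements, hence the grading.
\<close>

lemma coupling_Suc_split:
  assumes iso: "isometric_coupling (Suc n)" and v: "(v, v') \<in> coupling (Suc n)"
  obtains v0 v0' v1 v1' where "(v0, v0') \<in> graded_coupling (Suc n)" "(v1, v1') \<in> coupling n"
    "v = v0 + v1" "v' = v0' + v1'"
proof -
  have "v \<in> F_space X \<phi> (Suc n)" using coupling_F[OF v] by simp
  then obtain v0 v1 where v01: "v0 \<in> G_space X \<phi> (int (Suc n))" "v1 \<in> F_space X \<phi> n" "v = v0 + v1"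
    by (rule F_Suc_split[OF pX])
  obtain v1' where v1': "(v1, v1') \<in> coupling n" using coupling_total_left[OF v01(2)] by blast
  have d: "(v0, v' - v1') \<in> coupling (Suc n)"
    using coupling_diff[OF v coupling_mono[OF _ v1']] by (simp add: v01(3))
  have "t' \<bullet> (v' - v1') = 0" if t': "t' \<in> F_space Y \<psi> n" for t'
  proof -
    obtain t where t: "(t, t') \<in> coupling n" using coupling_total_right[OF t'] by blast
    have "t' \<bullet> (v' - v1') = t \<bullet> v0"
      using isometricD[OF iso coupling_mono[OF _ t] d] by simp
    then show ?thesis using G_orth[OF pX v01(1) _ conjunct1[OF coupling_F[OF t]]] by simp
  qed
  then have "v' - v1' \<in> G_space Y \<psi> (int (Suc n))"
    using coupling_F[OF d]
    by (simp add: G_space_def orthogonal_comp_def orthogonal_def nat_add_distrib)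
  then have "(v0, v' - v1') \<in> graded_coupling (Suc n)"
    using d v01(1) by (simp add: graded_coupling_def)
  then show ?thesis by (rule that[OF _ v1']) (simp_all add: v01(3))
qed

lemma graded_couplingD:
  assumes "(v, v') \<in> graded_coupling n"
  shows "(v, v') \<in> coupling n" "v \<in> G_space X \<phi> (int n)" "v' \<in> G_space Y \<psi> (int n)"
  using assms by (simp_all add: graded_coupling_def)

lemma graded_coupling_0: "graded_coupling 0 = coupling 0"
  using coupling_F[of _ _ 0] by (auto simp: graded_coupling_def G_space_def)

lemma lower_graded_0:
  assumes "(v, v') \<in> graded_coupling 0"
  shows "lower X \<phi> i v = 0" "lower Y \<psi> i v' = 0"
  using graded_couplingD[OF assms] lower_G_0[OF pX] lower_G_0[OF pY] by simp_all

text \<open>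
  By \<open>inner_lower\<close> the lowered vector is determined by products of vectors of degree at most \<open>n + 1\<close>.
  So isometry at level \<open>n + 1\<close> determines annihilation on the whole of \<open>F\<^sub>n\<^sub>+\<^sub>1\<close>, whereas the other two
  operators are determined only up to \<open>F\<^sub>n\<close>, as in \<open>keep_graded\<close> and \<open>raise_graded\<close>.
\<close>

lemma lower_graded_Suc:
  assumes iso: "isometric_coupling (Suc n)" and v: "(v, v') \<in> graded_coupling (Suc n)"
  shows "(lower X \<phi> i v, lower Y \<psi> i v') \<in> graded_coupling n"
proof -
  note g = graded_couplingD[OF v]
  note l = lower_G[OF pX g(2), of i] lower_G[OF pY g(3), of i]
  have "(lower X \<phi> i v, lower Y \<psi> i v') \<in> coupling n"
  proof (rule coupling_criterion[OF isometric_coupling_mono[OF iso]])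
    fix w :: "'d list" assume w: "length w \<le> n"
    have "lower X \<phi> i v \<bullet> vac_word X \<phi> w = v \<bullet> vac_word X \<phi> (i # w)"
      using inner_lower[OF pX g(2) vac_word_F[OF pX w], of i] by (simp add: X_W[OF pX])
    moreover have "lower Y \<psi> i v' \<bullet> vac_word Y \<psi> w = v' \<bullet> vac_word Y \<psi> (i # w)"
      using inner_lower[OF pY g(3) vac_word_F[OF pY w], of i] by (simp add: X_W[OF pY])
    moreover have "v \<bullet> vac_word X \<phi> (i # w) = v' \<bullet> vac_word Y \<psi> (i # w)"
      using isometricD[OF iso g(1) coupling_word[of "i # w"]] w by simp
    ultimately show "lower X \<phi> i v \<bullet> vac_word X \<phi> w = lower Y \<psi> i v' \<bullet> vac_word Y \<psi> w" by simp
  qed (use l G_F[OF pX] G_F[OF pY] in auto)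
  then show ?thesis using l by (simp add: graded_coupling_def)
qed

lemma lower_graded:
  assumes iso: "isometric_coupling n" and v: "(v, v') \<in> graded_coupling n"
  shows "(lower X \<phi> i v, lower Y \<psi> i v') \<in> coupling n"
proof (cases n)
  case 0
  then show ?thesis using lower_graded_0[of v v' i] v by (simp add: coupling_0)
next
  case (Suc m)
  then show ?thesis
    using graded_couplingD(1)[OF lower_graded_Suc[of m v v' i]] iso v
    by (auto intro: coupling_mono[of m])
qed

text \<open>
  Against degree at most \<open>n\<close> preservation is multiplication minus annihilation, and multiplication
  of \<open>G\<^sub>n\<close> stays within level \<open>n + 1\<close>.
\<close>

lemma keep_graded:
  assumes iso: "isometric_coupling (Suc n)" and v: "(v, v') \<in> graded_coupling n"
  shows "(keep X \<phi> i v, keep Y \<psi> i v') \<in> graded_coupling n"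
proof -
  note g = graded_couplingD[OF v]
  note k = keep_G[OF pX g(2), of i] keep_G[OF pY g(3), of i]
  have iso_n: "isometric_coupling n" by (rule isometric_coupling_mono[OF iso]) simp
  have "(keep X \<phi> i v, keep Y \<psi> i v') \<in> coupling n"
  proof (rule coupling_criterion[OF iso_n])
    fix w :: "'d list" assume w: "length w \<le> n"
    note W = coupling_word[OF w]
    have "the (X i v) \<bullet> vac_word X \<phi> w = the (Y i v') \<bullet> vac_word Y \<psi> w"
      by (rule isometricD[OF iso coupling_mult[OF g(1)] coupling_mono[OF _ W]]) simp
    moreover have "lower X \<phi> i v \<bullet> vac_word X \<phi> w = lower Y \<psi> i v' \<bullet> vac_word Y \<psi> w"
      by (rule isometricD[OF iso_n lower_graded[OF iso_n v] W])
    ultimately show "keep X \<phi> i v \<bullet> vac_word X \<phi> w = keep Y \<psi> i v' \<bullet> vac_word Y \<psi> w"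
      using inner_mult_G[OF pX g(2) vac_word_F[OF pX w], of i]
        inner_mult_G[OF pY g(3) vac_word_F[OF pY w], of i] by simp
  qed (use k G_F[OF pX] G_F[OF pY] in auto)
  then show ?thesis using k by (simp add: graded_coupling_def)
qed

lemma raise_graded:
  assumes iso: "isometric_coupling (Suc n)" and v: "(v, v') \<in> graded_coupling n"
  shows "(raise X \<phi> i v, raise Y \<psi> i v') \<in> graded_coupling (Suc n)"
proof -
  note g = graded_couplingD[OF v]
  have iso_n: "isometric_coupling n" by (rule isometric_coupling_mono[OF iso]) simp
  have "(lower X \<phi> i v + keep X \<phi> i v, lower Y \<psi> i v' + keep Y \<psi> i v') \<in> coupling n"
    by (intro coupling_add lower_graded[OF iso_n v] graded_couplingD(1)[OF keep_graded[OF iso v]])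
  then have "(the (X i v) - (lower X \<phi> i v + keep X \<phi> i v),
      the (Y i v') - (lower Y \<psi> i v' + keep Y \<psi> i v')) \<in> coupling (Suc n)"
    by (intro coupling_diff coupling_mult[OF g(1)] coupling_mono[of n "Suc n"]) simp_all
  then have "(raise X \<phi> i v, raise Y \<psi> i v') \<in> coupling (Suc n)"
    by (simp add: mult_split[OF pX G_cyclic[OF pX g(2)]] mult_split[OF pY G_cyclic[OF pY g(3)]])
  then show ?thesis
    using raise_G[OF pX g(2)] raise_G[OF pY g(3)] by (simp add: graded_coupling_def)
qed

text \<open>
  Linearity extends what holds on each homogeneous part of the coupling to all of it.
\<close>

lemma operators_coupling_subspace:
  assumes A: "linear_operator A" "dom A = cyclic_space X \<phi>"
    and A': "linear_operator A'" "dom A' = cyclic_space Y \<psi>"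
    and S: "subspace S" and iso: "isometric_coupling n"
    and "\<And>m v v'. m \<le> n \<Longrightarrow> (v, v') \<in> graded_coupling m \<Longrightarrow> (the (A v), the (A' v')) \<in> S"
    and "(v, v') \<in> coupling n"
  shows "(the (A v), the (A' v')) \<in> S"
  using assms(6-8)
proof (induction n arbitrary: v v')
  case 0
  then show ?case using graded_coupling_0 by blast
next
  case (Suc n)
  have iso: "isometric_coupling n" by (rule isometric_coupling_mono[OF Suc.prems(1)]) simp
  obtain v0 v0' v1 v1' where s: "(v0, v0') \<in> graded_coupling (Suc n)" "(v1, v1') \<in> coupling n"
    "v = v0 + v1" "v' = v0' + v1'"
    by (rule coupling_Suc_split[OF Suc.prems(1,3)])
  have "(the (A v0), the (A' v0')) \<in> S" using Suc.prems(2)[OF le_refl s(1)] .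
  moreover have "(the (A v1), the (A' v1')) \<in> S"
    by (rule Suc.IH[OF iso Suc.prems(2) s(2)]) simp_all
  moreover have "(the (A v), the (A' v')) = (the (A v0), the (A' v0')) + (the (A v1), the (A' v1'))"
    using linear_operator_domD(2)[OF A(1), of v0 v1] linear_operator_domD(2)[OF A'(1), of v0' v1']
      coupling_cyclic[OF graded_couplingD(1)[OF s(1)]] coupling_cyclic[OF s(2)]
    by (simp add: s(3,4) A(2) A'(2))
  ultimately show ?case using subspace_add[OF S] by metis
qed

lemmas parts_coupling_subspace =
  operators_coupling_subspace[OF linear_operator_parts(1,2)[OF pX] linear_operator_parts(1,2)[OF pY]]
  operators_coupling_subspace[OF linear_operator_parts(3,4)[OF pX] linear_operator_parts(3,4)[OF pY]]
  operators_coupling_subspace[OF linear_operator_parts(5,6)[OF pX] linear_operator_parts(5,6)[OF pY]]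

context
  assumes iso: "\<And>n. isometric_coupling n"
begin

lemma lower_coupling_Suc:
  assumes "(v, v') \<in> coupling (Suc n)"
  shows "(lower X \<phi> i v, lower Y \<psi> i v') \<in> coupling n"
proof (rule parts_coupling_subspace(1)[OF subspace_coupling iso _ assms])
  fix m v v' assume m: "m \<le> Suc n" and v: "(v, v') \<in> graded_coupling m"
  show "(lower X \<phi> i v, lower Y \<psi> i v') \<in> coupling n"
  proof (cases m)
    case 0
    then show ?thesis using lower_graded_0[of v v' i] v by (simp add: coupling_0)
  next
    case (Suc k)
    then show ?thesis
      using coupling_mono[of k n] graded_couplingD(1)[OF lower_graded_Suc[OF iso, of v v' k i]] m v
      by simp
  qed
qed

lemma lower_coupling:
  assumes "(v, v') \<in> coupling n"
  shows "(lower X \<phi> i v, lower Y \<psi> i v') \<in> coupling n"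
  by (rule lower_coupling_Suc) (rule coupling_mono[OF _ assms], simp)

lemma keep_coupling:
  assumes "(v, v') \<in> coupling n"
  shows "(keep X \<phi> i v, keep Y \<psi> i v') \<in> coupling n"
  by (rule parts_coupling_subspace(2)[OF subspace_coupling iso _ assms])
    (rule coupling_mono, assumption, rule graded_couplingD(1)[OF keep_graded[OF iso]])

lemma raise_coupling:
  assumes "(v, v') \<in> coupling n"
  shows "(raise X \<phi> i v, raise Y \<psi> i v') \<in> coupling (Suc n)"
  by (rule parts_coupling_subspace(3)[OF subspace_coupling iso _ assms])
    (rule coupling_mono[OF _ graded_couplingD(1)[OF raise_graded[OF iso]]], simp)

lemma raise_lower_coupling:
  assumes v: "(v, v') \<in> coupling n"
  shows "(raise X \<phi> j (lower X \<phi> i v), raise Y \<psi> j (lower Y \<psi> i v')) \<in> coupling n"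
proof (cases n)
  case 0
  then show ?thesis
    using lower_F_0[OF pX] lower_F_0[OF pY] coupling_F[OF v] coupling_0
      linear_operator_domD(4)[OF linear_operator_parts(5)[OF pX]]
      linear_operator_domD(4)[OF linear_operator_parts(5)[OF pY]]
    by simp
next
  case (Suc m)
  then show ?thesis using raise_coupling[OF lower_coupling_Suc] v by simp
qed

lemma isometric_imp_same_commutators:
  "same_action q X \<phi> Y \<psi>
     (q_commutator q (annihilation X \<phi> i) (creation X \<phi> j))
     (q_commutator q (annihilation Y \<psi> i) (creation Y \<psi> j))"
  "same_action q X \<phi> Y \<psi>
     (q_commutator q (annihilation X \<phi> i) (preservation X \<phi> j))
     (q_commutator q (annihilation Y \<psi> i) (preservation Y \<psi> j))"
proof -
  note parts = cyclic_operator_parts[OF pX] cyclic_operator_parts[OF pY]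
  show "same_action q X \<phi> Y \<psi>
      (q_commutator q (annihilation X \<phi> i) (creation X \<phi> j))
      (q_commutator q (annihilation Y \<psi> i) (creation Y \<psi> j))"
    unfolding same_action_q_commutator_iff[OF parts(1,4,3,6)] real_commutator_def
    using lower_coupling_Suc[OF raise_coupling] raise_lower_coupling
    by (auto intro!: coupling_diff coupling_scale)
  show "same_action q X \<phi> Y \<psi>
      (q_commutator q (annihilation X \<phi> i) (preservation X \<phi> j))
      (q_commutator q (annihilation Y \<psi> i) (preservation Y \<psi> j))"
    unfolding same_action_q_commutator_iff[OF parts(1,4,2,5)] real_commutator_def
    by (auto intro!: coupling_diff coupling_scale lower_coupling keep_coupling)
qed

end

section \<open>The commutators determine the next level of moments\<close>

lemma coupling_0_scale:
  assumes "(v, v') \<in> coupling 0"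
  obtains a where "v = a *\<^sub>R \<phi>" "v' = a *\<^sub>R \<psi>"
  using assms unfolding coupling_coefficients
  by (auto simp: vacuum(1)[OF pX] vacuum(1)[OF pY])

text \<open>
  Preservation on the top degree of an isometric coupling.  It is tested on words: the empty word sees
  only degree \<open>0\<close>, where the mean decides, and for a word \<open>j # u\<close> the letter is moved over as
  \<open>a\<^sup>-(j)a\<^sup>0(i)v\<close>.  Commuting leaves \<open>a\<^sup>0(i)\<close> applied to a vector of degree \<open>n - 1\<close>, where
  \<open>keep_graded\<close> applies.
\<close>

lemma keep_graded_from_commutator:
  assumes iso: "isometric_coupling n" and v: "(v, v') \<in> graded_coupling n"
    and commutator: "\<And>j. (real_commutator c (annihilation X \<phi> j) (preservation X \<phi> i) v,
        real_commutator c (annihilation Y \<psi> j) (preservation Y \<psi> i) v') \<in> coupling n"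
    and mean: "expectation \<phi> (X i) = expectation \<psi> (Y i)"
  shows "(keep X \<phi> i v, keep Y \<psi> i v') \<in> coupling n"
proof -
  note g = graded_couplingD[OF v]
  note k = keep_G[OF pX g(2), of i] keep_G[OF pY g(3), of i]
  show ?thesis
  proof (rule coupling_criterion[OF iso])
    show "keep X \<phi> i v \<in> F_space X \<phi> n" "keep Y \<psi> i v' \<in> F_space Y \<psi> n"
      using k G_F[OF pX] G_F[OF pY] by auto
  next
    fix w :: "'d list" assume w: "length w \<le> n"
    show "keep X \<phi> i v \<bullet> vac_word X \<phi> w = keep Y \<psi> i v' \<bullet> vac_word Y \<psi> w"
    proof (cases n)
      case 0
      then obtain a where a: "v = a *\<^sub>R \<phi>" "v' = a *\<^sub>R \<psi>" using coupling_0_scale g(1) by blast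
      have "keep X \<phi> i v \<bullet> \<phi> = the (X i v) \<bullet> \<phi>"
        using inner_mult_G[OF pX g(2) vacuum(3)[OF pX], of i] lower_graded_0(1)[of v v' i] v 0
        by simp
      also have "\<dots> = a * expectation \<phi> (X i)"
        using X_sym[OF pX G_cyclic[OF pX g(2)] F_cyclic[OF pX vacuum(3)[OF pX]], of i]
        by (simp add: a expectation_def inner_commute)
      finally have x: "keep X \<phi> i v \<bullet> \<phi> = a * expectation \<phi> (X i)" .
      have "keep Y \<psi> i v' \<bullet> \<psi> = the (Y i v') \<bullet> \<psi>"
        using inner_mult_G[OF pY g(3) vacuum(3)[OF pY], of i] lower_graded_0(2)[of v v' i] v 0
        by simp
      also have "\<dots> = a * expectation \<psi> (Y i)"
        using X_sym[OF pY G_cyclic[OF pY g(3)] F_cyclic[OF pY vacuum(3)[OF pY]], of i]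
        by (simp add: a expectation_def inner_commute)
      finally show ?thesis
        using x w 0 mean by (simp add: vacuum(1)[OF pX] vacuum(1)[OF pY])
    next
      case (Suc m)
      show ?thesis
      proof (cases w)
        case Nil
        then show ?thesis
          using G_orth[OF pX k(1) _ vacuum(3)[OF pX], of m] G_orth[OF pY k(2) _ vacuum(3)[OF pY], of m] Suc
          by (simp add: vacuum(1)[OF pX] vacuum(1)[OF pY] inner_commute)
      next
        case (Cons j u)
        have u: "length u \<le> m" using w Cons Suc by simp
        have iso_Suc: "isometric_coupling (Suc m)" and v_Suc: "(v, v') \<in> graded_coupling (Suc m)"
          using iso v Suc by simp_all
        have x: "keep X \<phi> i v \<bullet> vac_word X \<phi> w = lower X \<phi> j (keep X \<phi> i v) \<bullet> vac_word X \<phi> u"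
          using inner_lower[OF pX k(1)[unfolded Suc] vac_word_F[OF pX u], of j] Cons
          by (simp add: X_W[OF pX])
        have y: "keep Y \<psi> i v' \<bullet> vac_word Y \<psi> w = lower Y \<psi> j (keep Y \<psi> i v') \<bullet> vac_word Y \<psi> u"
          using inner_lower[OF pY k(2)[unfolded Suc] vac_word_F[OF pY u], of j] Cons
          by (simp add: X_W[OF pY])
        have "(keep X \<phi> i (lower X \<phi> j v), keep Y \<psi> i (lower Y \<psi> j v')) \<in> coupling n"
          using graded_couplingD(1)[OF keep_graded[OF iso_Suc lower_graded_Suc[OF iso_Suc v_Suc]]]
          by (rule coupling_mono[rotated]) (simp add: Suc)
        from coupling_add[OF commutator[of j] coupling_scale[OF this, of c]]
        have "(lower X \<phi> j (keep X \<phi> i v), lower Y \<psi> j (keep Y \<psi> i v')) \<in> coupling n"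
          by (simp add: real_commutator_def)
        from isometricD[OF iso this coupling_word] u Suc x y
        show ?thesis by simp
      qed
    qed
  qed
qed

text \<open>
  The same exchange for creation.  The raised vectors lie beyond the coupling, so the conclusion is
  about inner products, and \<open>a\<^sup>-(j)a\<^sup>+(i)v\<close> is again of degree \<open>n\<close>.
\<close>

lemma raise_inner_from_commutator:
  assumes iso: "isometric_coupling n" and v: "(v, v') \<in> graded_coupling n"
    and w: "(w, w') \<in> coupling n"
    and commutator: "(real_commutator c (annihilation X \<phi> j) (creation X \<phi> i) v,
        real_commutator c (annihilation Y \<psi> j) (creation Y \<psi> i) v') \<in> coupling n"
  shows "raise X \<phi> i v \<bullet> the (X j w) = raise Y \<psi> i v' \<bullet> the (Y j w')"
proof -
  note g = graded_couplingD[OF v]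
  have "(raise X \<phi> i (lower X \<phi> j v), raise Y \<psi> i (lower Y \<psi> j v')) \<in> coupling n"
  proof (cases n)
    case 0
    then show ?thesis
      using lower_graded_0[of v v' j] v coupling_0
        linear_operator_domD(4)[OF linear_operator_parts(5)[OF pX]]
        linear_operator_domD(4)[OF linear_operator_parts(5)[OF pY]]
      by simp
  next
    case (Suc m)
    then show ?thesis
      using graded_couplingD(1)[OF raise_graded[OF _ lower_graded_Suc]] iso v by simp
  qed
  from coupling_add[OF commutator coupling_scale[OF this, of c]]
  have "(lower X \<phi> j (raise X \<phi> i v), lower Y \<psi> j (raise Y \<psi> i v')) \<in> coupling n"
    by (simp add: real_commutator_def)
  from isometricD[OF iso this w] show ?thesis
    using inner_lower[OF pX raise_G[OF pX g(2)] conjunct1[OF coupling_F[OF w]]]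
      inner_lower[OF pY raise_G[OF pY g(3)] conjunct2[OF coupling_F[OF w]]]
    by simp
qed

text \<open>
  Multiplication leaves level \<open>n\<close> only through the creation part of the component in \<open>G\<^sub>n\<close>.
\<close>

lemma coupling_mult_split:
  assumes iso: "isometric_coupling n" and v: "(v, v') \<in> coupling n"
    and keep: "\<And>i v v'. (v, v') \<in> graded_coupling n \<Longrightarrow>
      (keep X \<phi> i v, keep Y \<psi> i v') \<in> coupling n"
  obtains b b' u u' where "(b, b') \<in> coupling n" "(u, u') \<in> graded_coupling n"
    "the (X i v) = b + raise X \<phi> i u" "the (Y i v') = b' + raise Y \<psi> i u'"
proof -
  have "\<exists>u u' t t'. (u, u') \<in> graded_coupling n \<and> v = u + t \<and> v' = u' + t' \<and>
      (the (X i t), the (Y i t')) \<in> coupling n \<and> t \<in> cyclic_space X \<phi> \<and> t' \<in> cyclic_space Y \<psi>"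
  proof (cases n)
    case 0
    then show ?thesis
      using v graded_coupling_0 coupling_0 coupling_cyclic[OF coupling_0]
        linear_operator_domD(4)[OF linX[OF pX]] linear_operator_domD(4)[OF linX[OF pY]]
      by (intro exI[of _ v] exI[of _ v'] exI[of _ 0]) simp
  next
    case (Suc m)
    from coupling_Suc_split[OF iso[unfolded Suc] v[unfolded Suc]]
    show ?thesis using Suc coupling_mult coupling_cyclic by metis
  qed
  then obtain u u' t t' where u: "(u, u') \<in> graded_coupling n" and s: "v = u + t" "v' = u' + t'"
    and t: "(the (X i t), the (Y i t')) \<in> coupling n" "t \<in> cyclic_space X \<phi>" "t' \<in> cyclic_space Y \<psi>"
    by blast
  note g = graded_couplingD[OF u]
  let ?b = "the (X i t) + (lower X \<phi> i u + keep X \<phi> i u)"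
  let ?b' = "the (Y i t') + (lower Y \<psi> i u' + keep Y \<psi> i u')"
  have "(?b, ?b') \<in> coupling n" by (intro coupling_add t lower_graded[OF iso u] keep[OF u])
  moreover have "the (X i v) = ?b + raise X \<phi> i u"
    using linear_operator_domD(2)[OF linX[OF pX], of u i t] cyclic_dom[OF pX, of i]
      G_cyclic[OF pX g(2)] t(2)
    by (simp add: s mult_split[OF pX] subset_iff)
  moreover have "the (Y i v') = ?b' + raise Y \<psi> i u'"
    using linear_operator_domD(2)[OF linX[OF pY], of u' i t'] cyclic_dom[OF pY, of i]
      G_cyclic[OF pY g(3)] t(3)
    by (simp add: s mult_split[OF pY] subset_iff)
  ultimately show ?thesis using that u by blast
qed

text \<open>
  Each word of length at most \<open>n + 1\<close> gives a vector of level \<open>n\<close> plus a raised vector, and the cross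
  terms vanish by orthogonality.  Isometry at level \<open>n\<close> handles the former, and the latter are left to
  \<open>raise_inner_from_commutator\<close>.
\<close>

lemma isometric_Suc_from_commutators:
  assumes iso: "isometric_coupling n"
    and creation: "\<And>i j v v'. (v, v') \<in> coupling n \<Longrightarrow>
      (real_commutator c (annihilation X \<phi> j) (creation X \<phi> i) v,
       real_commutator c (annihilation Y \<psi> j) (creation Y \<psi> i) v') \<in> coupling n"
    and preservation: "\<And>i j v v'. (v, v') \<in> coupling n \<Longrightarrow>
      (real_commutator c (annihilation X \<phi> j) (preservation X \<phi> i) v,
       real_commutator c (annihilation Y \<psi> j) (preservation Y \<psi> i) v') \<in> coupling n"
    and mean: "\<And>i. expectation \<phi> (X i) = expectation \<psi> (Y i)"
  shows "isometric_coupling (Suc n)"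
proof (rule isometric_coupling_words)
  have keep: "(keep X \<phi> i v, keep Y \<psi> i v') \<in> coupling n" if "(v, v') \<in> graded_coupling n" for i v v'
    by (rule keep_graded_from_commutator[OF iso that preservation mean])
      (rule graded_couplingD(1)[OF that])
  have split: "\<exists>b b' i u u'. (b, b') \<in> coupling n \<and> (u, u') \<in> graded_coupling n \<and>
      vac_word X \<phi> w = b + raise X \<phi> i u \<and> vac_word Y \<psi> w = b' + raise Y \<psi> i u'"
    if w: "length w \<le> Suc n" for w
  proof (cases "length w \<le> n")
    case True
    \<comment> \<open>A short word is already of level \<open>n\<close>; the raised vector is the image of \<open>0\<close>.\<close>
    have "(0, 0) \<in> graded_coupling n"
      using coupling_0 subspace_0[OF subspace_G[OF pX]] subspace_0[OF subspace_G[OF pY]]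
      by (simp add: graded_coupling_def)
    then show ?thesis
      using coupling_word[OF True] linear_operator_domD(4)[OF linear_operator_parts(5)[OF pX]]
        linear_operator_domD(4)[OF linear_operator_parts(5)[OF pY]]
      by (intro exI[of _ "vac_word X \<phi> w"] exI[of _ "vac_word Y \<psi> w"] exI exI[of _ 0]) simp
  next
    case False
    then obtain i t where t: "w = i # t" "length t \<le> n" using w by (cases w) auto
    show ?thesis
      by (rule coupling_mult_split[OF iso coupling_word[OF t(2)] keep, of i])
        (auto simp: t(1) X_W[OF pX] X_W[OF pY] intro!: exI conjI)
  qed
  fix w1 w2 :: "'d list" assume w12: "length w1 \<le> Suc n" "length w2 \<le> Suc n"
  obtain b b' i u u' where 1: "(b, b') \<in> coupling n" "(u, u') \<in> graded_coupling n"
    "vac_word X \<phi> w1 = b + raise X \<phi> i u" "vac_word Y \<psi> w1 = b' + raise Y \<psi> i u'"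
    using split[OF w12(1)] by blast
  obtain d d' j t t' where 2: "(d, d') \<in> coupling n" "(t, t') \<in> graded_coupling n"
    "vac_word X \<phi> w2 = d + raise X \<phi> j t" "vac_word Y \<psi> w2 = d' + raise Y \<psi> j t'"
    using split[OF w12(2)] by blast
  note gu = graded_couplingD[OF 1(2)] and gt = graded_couplingD[OF 2(2)]
  have oX: "z \<bullet> raise X \<phi> k s = 0 \<and> raise X \<phi> k s \<bullet> z = 0"
    if "z \<in> F_space X \<phi> n" "s \<in> G_space X \<phi> (int n)" for z k s
    using G_orth[OF pX raise_G[OF pX that(2)] _ that(1)] by (simp add: inner_commute)
  have oY: "z \<bullet> raise Y \<psi> k s = 0 \<and> raise Y \<psi> k s \<bullet> z = 0"
    if "z \<in> F_space Y \<psi> n" "s \<in> G_space Y \<psi> (int n)" for z k s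
    using G_orth[OF pY raise_G[OF pY that(2)] _ that(1)] by (simp add: inner_commute)
  \<comment> \<open>\<open>X\<^sub>j t\<close> differs from the raised vector only by terms of degree at most \<open>n\<close>.\<close>
  have "raise X \<phi> i u \<bullet> the (X j t) = raise X \<phi> i u \<bullet> raise X \<phi> j t"
    using oX[OF lower_F[OF pX G_F[OF pX gt(2)]] gu(2)] oX[OF keep_F[OF pX G_F[OF pX gt(2)]] gu(2)]
    by (simp add: mult_split[OF pX G_cyclic[OF pX gt(2)]] inner_add_right)
  moreover have "raise Y \<psi> i u' \<bullet> the (Y j t') = raise Y \<psi> i u' \<bullet> raise Y \<psi> j t'"
    using oY[OF lower_F[OF pY G_F[OF pY gt(3)]] gu(3)] oY[OF keep_F[OF pY G_F[OF pY gt(3)]] gu(3)]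
    by (simp add: mult_split[OF pY G_cyclic[OF pY gt(3)]] inner_add_right)
  moreover have "raise X \<phi> i u \<bullet> the (X j t) = raise Y \<psi> i u' \<bullet> the (Y j t')"
    by (rule raise_inner_from_commutator[OF iso 1(2) gt(1) creation[OF gu(1)]])
  ultimately show "vac_word X \<phi> w1 \<bullet> vac_word X \<phi> w2 = vac_word Y \<psi> w1 \<bullet> vac_word Y \<psi> w2"
    using isometricD[OF iso 1(1) 2(1)] coupling_F[OF 1(1)] coupling_F[OF 2(1)] gu(2,3) gt(2,3)
    by (simp add: 1(3,4) 2(3,4) inner_add_left inner_add_right oX oY)
qed

lemma isometric_coupling_0: "isometric_coupling 0"
  by (rule isometric_coupling_words) (simp add: vacuum[OF pX] vacuum[OF pY])

end

section \<open>Moment equality and q-commutators\<close>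

theorem theorem3p1:
  fixes q :: complex
    and X :: "'d::finite \<Rightarrow> 'a::{real_inner, complete_space} \<rightharpoonup> 'a" and \<phi> :: 'a
    and Y :: "'d \<Rightarrow> 'b::{real_inner, complete_space} \<rightharpoonup> 'b" and \<psi> :: 'b
  assumes "probability_space X \<phi>" and "probability_space Y \<psi>"
  shows "moment_equal X \<phi> Y \<psi> \<longleftrightarrow>
    (\<forall>i j.
      same_action q X \<phi> Y \<psi>
        (q_commutator q (annihilation X \<phi> i) (creation X \<phi> j))
        (q_commutator q (annihilation Y \<psi> i) (creation Y \<psi> j)) \<and>
      same_action q X \<phi> Y \<psi>
        (q_commutator q (annihilation X \<phi> i) (preservation X \<phi> j))
        (q_commutator q (annihilation Y \<psi> i) (preservation Y \<psi> j)) \<and>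
      expectation \<phi> (X i) = expectation \<psi> (Y i))"
    (is "?M \<longleftrightarrow> (\<forall>i j. ?C i j \<and> ?P i j \<and> ?E i)")
proof
  assume ?M
  then have iso: "isometric_coupling X \<phi> Y \<psi> n" for n
    using moment_equal_iff_isometric[OF assms] by simp
  have "?E i" for i
    using isometricD[OF assms iso coupling_word[OF assms, of "[i]" 1] coupling_vacuum[OF assms]]
    by (simp add: expectation_def vacuum(2)[OF assms(1)] vacuum(2)[OF assms(2)])
  then show "\<forall>i j. ?C i j \<and> ?P i j \<and> ?E i"
    using isometric_imp_same_commutators[OF assms iso] by simp
next
  assume R: "\<forall>i j. ?C i j \<and> ?P i j \<and> ?E i"
  note parts = cyclic_operator_parts[OF assms(1)] cyclic_operator_parts[OF assms(2)]
  have creation: "(real_commutator (Re q) (annihilation X \<phi> j) (creation X \<phi> i) v,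
      real_commutator (Re q) (annihilation Y \<psi> j) (creation Y \<psi> i) v') \<in> coupling X \<phi> Y \<psi> n"
    if "(v, v') \<in> coupling X \<phi> Y \<psi> n" for i j n v v'
    using R[rule_format, THEN conjunct1, of j i] that
    unfolding same_action_q_commutator_iff[OF assms parts(1,4,3,6)] by blast
  have preservation: "(real_commutator (Re q) (annihilation X \<phi> j) (preservation X \<phi> i) v,
      real_commutator (Re q) (annihilation Y \<psi> j) (preservation Y \<psi> i) v') \<in> coupling X \<phi> Y \<psi> n"
    if "(v, v') \<in> coupling X \<phi> Y \<psi> n" for i j n v v'
    using R[rule_format, THEN conjunct2, THEN conjunct1, of j i] that
    unfolding same_action_q_commutator_iff[OF assms parts(1,4,2,5)] by blast
  have "isometric_coupling X \<phi> Y \<psi> n" for n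
  proof (induction n)
    case 0
    show ?case by (rule isometric_coupling_0[OF assms])
  next
    case (Suc n)
    then show ?case
      by (rule isometric_Suc_from_commutators[OF assms _ creation preservation]) (use R in auto)
  qed
  then show ?M by (simp add: moment_equal_iff_isometric[OF assms])
qed

end
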